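(* Assume that the parameters $(t,\{a_i\},\{b_j\})$ of the Hall--Littlewood process and the parameters $(Q,\{\xi_x\},\{u_y\})$ of the stochastic six vertex model are related by $t=Q$, $a_x=\sqrt t/\xi_x$ for all $x\ge1$, $b_y=1/(t\,u_y)$ for all $y\ge1$. Then for any positive integers $M,N$ and any string $S\in\mathcal S^+_{M,N}$, the random vectors $$\{\lambda_1'(i,N,S)\}_{i=1}^{M+N-1}\qquad\text{and}\qquad \{\,y_i(S)-h(x_i(S)+1,\,y_i(S))\,\}_{i=1}^{M+N-1}$$ are identically distributed.
   Context: **Partitions and Hall--Littlewood functions.** A partition $\lambda$ is a finite non-increasing sequence of positive integers; $\lambda_1'$ denotes its number of parts (length of the first column), $|\lambda|$ the sum of its parts, $m_i(\lambda)$ the number of parts equal to $i\ge 1$. Write $\mu\prec\lambda$ if $\lambda_1\ge\mu_1\ge\lambda_2\ge\mu_2\ge\cdots$. Fix $0<t<1$. The one-variable skew Hall--Littlewood polynomials are $P_{\lambda/\mu}(a)=a^{|\lambda|-|\mu|}\prod_{i\ge1:\,m_i(\lambda)+1=m_i(\mu)}(1-t^{m_i(\mu)})$ and $Q_{\lambda/\mu}(b)=b^{|\lambda|-|\mu|}\prod_{i\ge1:\,m_i(\lambda)=m_i(\mu)+1}(1-t^{m_i(\lambda)})$ if $\mu\prec\lambda$, and both are $0$ otherwise. **Strings.** $\mathcal S^+_{M,N}$ is the set of strings $S=(S(1),\dots,S(M+N))$ of signs with $M$ pluses and $N$ minuses such that $S(1)=+$ and $S(M+N)=-$. Let $p(i)$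 and $m(i)$ be the numbers of pluses and minuses in $(S(1),\dots,S(i))$. **Hall--Littlewood process.** Let $a_i>0$, $b_j>0$ with $a_ib_j<1$ for all $i,j\ge1$. For $S\in\mathcal S^+_{M,N}$, with the convention $\lambda^{(0)}=\lambda^{(M+N)}=\varnothing$, define a probability measure on sequences of partitions $(\lambda^{(1)},\dots,\lambda^{(M+N-1)})$ by $$\mathrm{Prob}^S_{M,N}(\lambda^{(1)},\dots,\lambda^{(M+N-1)})=\frac{1}{\Pi^S}\prod_{i=1}^{M+N}W_i,\qquad W_i=\begin{cases}P_{\lambda^{(i)}/\lambda^{(i-1)}}(a_{p(i)}),&S(i)=+,\\ Q_{\lambda^{(i-1)}/\lambda^{(i)}}(b_{N-m(i)+1}),&S(i)=-,\end{cases}$$ $$\Pi^S=\prod_{i<j:\ S(i)=+,\,S(j)=-}\frac{1-ta_{p(i)}b_{N-m(j)+1}}{1-a_{p(i)}b_{N-m(j)+1}} .$$ $\lambda_1'(i,N,S)$ denotes the length of the first column of the random partition $\lambda^{(i)}$. **Down-right path.** Given $S\in\mathcal S^+_{M,N}$, the points $(x_i(S),y_i(S))$, $0\le i\le M+N$, are defined by $(x_0,y_0)=(0,N)$, and $(x_i,y_i)=(x_{i-1}+1,y_{i-1})$ if $S(i)=+$, $(x_i,y_i)=(x_{i-1},y_{i-1}-1)$ if $S(i)=-$; thus $(x_{M+N},y_{M+N})=(M,0)$. **Stochastic six vertex model in the quadrant.** Parameters: $0<Q<1$, $\xi_x>0$, $u_y>0$ with $\xi_xu_y>1/\sqrt Q$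 for all $x,y\ge1$. Vertices are the points $(x,y)\in\mathbb Z_{\ge1}^2$; each lattice edge may be occupied by an arrow (pointing right or up) or be empty. The left edge of each vertex $(1,y)$ is occupied, the bottom edge of each vertex $(x,1)$ is empty. Vertices are sampled successively in order of increasing $x+y$: given the occupation of the left and bottom edges of $(x,y)$, the occupations of its right and top edges are chosen (independently of everything else given these incoming edges) as follows: - left and bottom empty: right and top empty; left and bottom occupied: right and top occupied; - left occupied, bottom empty: only the right edge is occupied with probability $\frac{Q^{-1}-Q^{-1/2}\xi_xu_y}{1-Q^{-1/2}\xi_xu_y}$, only the top edge with probability $\frac{1-Q^{-1}}{1-Q^{-1/2}\xi_xu_y}$; - left empty, bottom occupied: only the top edge is occupied with probability $\frac{1-Q^{1/2}\xi_xu_y}{1-Q^{-1/2}\xi_xu_y}$, only the right edge with probability $\frac{(Q-1)Q^{-1/2}\xi_xu_y}{1-Q^{-1/2}\xi_xu_y}$. The occupied edges form up-right paths. The height function $h(x,y)$ is the number of up-right paths which go through or to the right of the point $(x,y)$; equivalently, $h(x,y)$ is the number of $y'\in\{1,\dots,y\}$ such that the left edge of the vertex $(x,y')$ is occupied. *)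

theory Defs
  imports "HOL-Probability.Probability"
begin

section \<open>Partitions and one-variable skew Hall--Littlewood polynomials\<close>

text \<open>A partition is the list of its (positive) parts; the length of its first column
  is the length of the list.\<close>

definition partitions :: "nat list set" where
  "partitions = {la. sorted_wrt (\<ge>) la \<and> (\<forall>k\<in>set la. k > 0)}"

text \<open>Parts are indexed from 0 here: \<open>part la i\<close> is the usual $\lambda_{i+1}$,
  which is 0 beyond the number of parts.\<close>

definition part :: "nat list \<Rightarrow> nat \<Rightarrow> nat" where
  "part la i = (if i < length la then la ! i else 0)"

definition interlaces :: "nat list \<Rightarrow> nat list \<Rightarrow> bool"  (infix "\<prec>\<^sub>p" 50) where
  "mu \<prec>\<^sub>p la \<longleftrightarrow> (\<forall>i. part la i \<ge> part mu i \<and> part mu i \<ge> part la (Suc i))"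

definition HL_P :: "real \<Rightarrow> nat list \<Rightarrow> nat list \<Rightarrow> real \<Rightarrow> real" where
  "HL_P t la mu a =
     (if mu \<prec>\<^sub>p la
      then a ^ (sum_list la - sum_list mu) *
           (\<Prod>i\<in>{i. i \<ge> 1 \<and> count_list la i + 1 = count_list mu i}. 1 - t ^ count_list mu i)
      else 0)"

definition HL_Q :: "real \<Rightarrow> nat list \<Rightarrow> nat list \<Rightarrow> real \<Rightarrow> real" where
  "HL_Q t la mu b =
     (if mu \<prec>\<^sub>p la
      then b ^ (sum_list la - sum_list mu) *
           (\<Prod>i\<in>{i. i \<ge> 1 \<and> count_list la i = count_list mu i + 1}. 1 - t ^ count_list la i)
      else 0)"

section \<open>Sign strings and down-right paths\<close>

datatype sign = Plus | Minus

text \<open>The sign $S(i)$, $i \ge 1$, is \<open>S ! (i - 1)\<close>.\<close>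

definition strings :: "nat \<Rightarrow> nat \<Rightarrow> sign list set" where
  "strings M N = {S. count_list S Plus = M \<and> count_list S Minus = N \<and>
                     hd S = Plus \<and> last S = Minus}"

definition pluses :: "sign list \<Rightarrow> nat \<Rightarrow> nat" where
  "pluses S i = count_list (take i S) Plus"

definition minuses :: "sign list \<Rightarrow> nat \<Rightarrow> nat" where
  "minuses S i = count_list (take i S) Minus"

text \<open>For \<open>S \<in> strings M N\<close> the subtraction below is never truncated, because
  \<open>S\<close> has exactly \<open>N\<close> minuses.\<close>

primrec dr_path :: "nat \<Rightarrow> sign list \<Rightarrow> nat \<Rightarrow> nat \<times> nat" where
  "dr_path N S 0 = (0, N)"
| "dr_path N S (Suc i) =
     (case dr_path N S i of (x, y) \<Rightarrow>
        (case S ! i of Plus \<Rightarrow> (x + 1, y) | Minus \<Rightarrow> (x, y - 1)))"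

definition path_x :: "nat \<Rightarrow> sign list \<Rightarrow> nat \<Rightarrow> nat" where
  "path_x N S i = fst (dr_path N S i)"

definition path_y :: "nat \<Rightarrow> sign list \<Rightarrow> nat \<Rightarrow> nat" where
  "path_y N S i = snd (dr_path N S i)"

section \<open>The Hall--Littlewood process\<close>

text \<open>A sequence $(\lambda^{(1)},\dots,\lambda^{(L-1)})$ of partitions is a function on all
  naturals; its value \<open>[]\<close> at 0 and from \<open>L\<close> on encodes the convention
  $\lambda^{(0)} = \lambda^{(L)} = \emptyset$.\<close>

definition partition_seqs :: "nat \<Rightarrow> (nat \<Rightarrow> nat list) set" where
  "partition_seqs L = {\<Lambda>. (\<forall>i. \<Lambda> i \<in> partitions) \<and> (\<forall>i. i = 0 \<or> i \<ge> L \<longrightarrow> \<Lambda> i = [])}"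

definition HL_factor ::
  "real \<Rightarrow> (nat \<Rightarrow> real) \<Rightarrow> (nat \<Rightarrow> real) \<Rightarrow> nat \<Rightarrow> sign list \<Rightarrow> (nat \<Rightarrow> nat list) \<Rightarrow> nat \<Rightarrow> real" where
  "HL_factor t a b N S \<Lambda> i =
     (case S ! (i - 1) of
        Plus \<Rightarrow> HL_P t (\<Lambda> i) (\<Lambda> (i - 1)) (a (pluses S i))
      | Minus \<Rightarrow> HL_Q t (\<Lambda> (i - 1)) (\<Lambda> i) (b (N - minuses S i + 1)))"

definition HL_norm ::
  "real \<Rightarrow> (nat \<Rightarrow> real) \<Rightarrow> (nat \<Rightarrow> real) \<Rightarrow> nat \<Rightarrow> nat \<Rightarrow> sign list \<Rightarrow> real" where
  "HL_norm t a b M N S =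
     (\<Prod>(i, j)\<in>{(i, j). 1 \<le> i \<and> i < j \<and> j \<le> M + N \<and> S ! (i - 1) = Plus \<and> S ! (j - 1) = Minus}.
        (1 - t * a (pluses S i) * b (N - minuses S j + 1)) /
        (1 - a (pluses S i) * b (N - minuses S j + 1)))"

definition HL_process ::
  "real \<Rightarrow> (nat \<Rightarrow> real) \<Rightarrow> (nat \<Rightarrow> real) \<Rightarrow> nat \<Rightarrow> nat \<Rightarrow> sign list \<Rightarrow> (nat \<Rightarrow> nat list) measure" where
  "HL_process t a b M N S =
     density (count_space (partition_seqs (M + N)))
       (\<lambda>\<Lambda>. ennreal (1 / HL_norm t a b M N S * (\<Prod>i\<in>{1..M + N}. HL_factor t a b N S \<Lambda> i)))"

section \<open>The stochastic six vertex model in the quadrant\<close>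

text \<open>Law of the (right, top) occupations of a vertex given its (left, bottom) occupations,
  where \<open>z\<close> is the product of the column and row parameters of the vertex.\<close>

fun vertex_pmf :: "real \<Rightarrow> real \<Rightarrow> bool \<times> bool \<Rightarrow> (bool \<times> bool) pmf" where
  "vertex_pmf Q z (False, False) = return_pmf (False, False)"
| "vertex_pmf Q z (True, True) = return_pmf (True, True)"
| "vertex_pmf Q z (True, False) =
     map_pmf (\<lambda>r. (r, \<not> r)) (bernoulli_pmf ((1 / Q - z / sqrt Q) / (1 - z / sqrt Q)))"
| "vertex_pmf Q z (False, True) =
     map_pmf (\<lambda>u. (\<not> u, u)) (bernoulli_pmf ((1 - sqrt Q * z) / (1 - z / sqrt Q)))"

text \<open>Since \<open>bernoulli_pmf\<close> truncates its argument to the unit interval and fixes the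
  second probability as a complement, we check that the four nontrivial weights are the
  intended ones in the parameter range of the model.\<close>

lemma vertex_pmf_weights:
  assumes Q: "0 < Q" "Q < 1" and z: "z > 1 / sqrt Q"
  shows "pmf (vertex_pmf Q z (True, False)) (True, False) = (1 / Q - z / sqrt Q) / (1 - z / sqrt Q)" (is ?A)
    and "pmf (vertex_pmf Q z (True, False)) (False, True) = (1 - 1 / Q) / (1 - z / sqrt Q)" (is ?B)
    and "pmf (vertex_pmf Q z (False, True)) (False, True) = (1 - sqrt Q * z) / (1 - z / sqrt Q)" (is ?C)
    and "pmf (vertex_pmf Q z (False, True)) (True, False) =
           ((Q - 1) / sqrt Q * z) / (1 - z / sqrt Q)" (is ?D)
proof -
  have sq: "sqrt Q > 0" "sqrt Q * sqrt Q = Q" using Q by auto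
  have z1: "sqrt Q * z > 1" using z sq by (simp add: field_simps)
  have "z / sqrt Q = (sqrt Q * z) / Q" using sq by (simp add: field_simps)
  then have d: "z / sqrt Q > 1 / Q" using z1 Q by (simp add: divide_strict_right_mono)
  have Q1: "1 / Q > 1" using Q by simp
  have d1: "1 - z / sqrt Q < 0" using d Q1 by linarith
  have q1: "(1 / Q - z / sqrt Q) / (1 - z / sqrt Q) \<in> {0..1}"
    using d d1 Q1 by (auto simp: divide_nonpos_neg neg_divide_le_eq)
  have "Q * (z / sqrt Q) < z / sqrt Q" using mult_strict_right_mono[of Q 1 "z / sqrt Q"] Q d1 by linarith
  moreover have "sqrt Q * z = Q * (z / sqrt Q)" using sq by (simp add: field_simps)
  ultimately have "z / sqrt Q \<ge> sqrt Q * z" by simp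
  then have q2: "(1 - sqrt Q * z) / (1 - z / sqrt Q) \<in> {0..1}"
    using z1 d1 by (auto simp: divide_nonpos_neg neg_divide_le_eq)
  have i1: "inj (\<lambda>r. (r, \<not> r))" and i2: "inj (\<lambda>u. (\<not> u, u))" by (auto simp: inj_def)
  note m1 = pmf_map_inj'[OF i1, simplified] and m2 = pmf_map_inj'[OF i2, simplified]
  have e: "1 - p / q = (q - p) / q" if "q \<noteq> 0" for p q :: real
    using that by (simp add: diff_divide_distrib)
  show ?A using m1[of _ True] q1 by simp
  have "pmf (vertex_pmf Q z (True, False)) (False, True) = 1 - (1 / Q - z / sqrt Q) / (1 - z / sqrt Q)"
    using m1[of _ False] q1 by simp
  also have "\<dots> = (1 - 1 / Q) / (1 - z / sqrt Q)" by (subst e) (use d1 in auto)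
  finally show ?B .
  show ?C using m2[of _ True] q2 by simp
  have "pmf (vertex_pmf Q z (False, True)) (True, False) = 1 - (1 - sqrt Q * z) / (1 - z / sqrt Q)"
    using m2[of _ False] q2 by simp
  also have "\<dots> = (sqrt Q * z - z / sqrt Q) / (1 - z / sqrt Q)"
    by (subst e) (use d1 in auto)
  also have "sqrt Q * z - z / sqrt Q = (Q - 1) / sqrt Q * z" using sq by (simp add: field_simps)
  finally show ?D .
qed

definition vertices :: "(nat \<times> nat) set" where
  "vertices = {1..} \<times> {1..}"

text \<open>For every vertex and every possible state of its incoming (left, bottom) edges, an
  outcome for the outgoing (right, top) edges is drawn from \<open>vertex_pmf\<close>, all draws being
  independent; a vertex then uses the draw that belongs to its actual incoming edges.\<close>

definition vertex_draws ::
  "real \<Rightarrow> (nat \<Rightarrow> real) \<Rightarrow> (nat \<Rightarrow> real) \<Rightarrow> ((nat \<times> nat) \<times> (bool \<times> bool) \<Rightarrow> bool \<times> bool) measure" where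
  "vertex_draws Q \<xi> u =
     (\<Pi>\<^sub>M ((x, y), s)\<in>vertices \<times> UNIV. measure_pmf (vertex_pmf Q (\<xi> x * u y) s))"

fun incoming ::
  "((nat \<times> nat) \<times> (bool \<times> bool) \<Rightarrow> bool \<times> bool) \<Rightarrow> nat \<times> nat \<Rightarrow> bool \<times> bool" where
  "incoming \<omega> (x, y) =
     (if x \<le> 1 then True else fst (\<omega> ((x - 1, y), incoming \<omega> (x - 1, y))),
      if y \<le> 1 then False else snd (\<omega> ((x, y - 1), incoming \<omega> (x, y - 1))))"

declare incoming.simps [simp del]

lemma measurable_incoming: "x \<ge> 1 \<Longrightarrow> y \<ge> 1 \<Longrightarrow>
  (\<lambda>\<omega>. incoming \<omega> (x,y)) \<in> vertex_draws Q \<xi> u \<rightarrow>\<^sub>M count_space UNIV"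
proof (induction "x + y" arbitrary: x y rule: less_induct)
  case less
  have out: "(\<lambda>\<omega>. \<omega> ((x', y'), incoming \<omega> (x', y'))) \<in> vertex_draws Q \<xi> u \<rightarrow>\<^sub>M count_space UNIV"
    if "x' + y' < x + y" "x' \<ge> 1" "y' \<ge> 1" for x' y'
  proof -
    have 1: "(\<lambda>\<omega>. \<omega> ((x', y'), s)) \<in> vertex_draws Q \<xi> u \<rightarrow>\<^sub>M count_space UNIV" for s
    proof -
      have "(\<lambda>\<omega>. \<omega> ((x', y'), s)) \<in> vertex_draws Q \<xi> u \<rightarrow>\<^sub>M measure_pmf (vertex_pmf Q (\<xi> x' * u y') s)"
        unfolding vertex_draws_def using that
          measurable_component_singleton[of "((x',y'),s)" "vertices \<times> UNIV" "\<lambda>((x, y), s). measure_pmf (vertex_pmf Q (\<xi> x * u y) s)"]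
        by (simp add: vertices_def)
      then show ?thesis by simp
    qed
    show ?thesis
      by (rule measurable_compose_countable[where f="\<lambda>s \<omega>. \<omega> ((x', y'), s)"]) (use 1 less.hyps that in auto)
  qed
  have a: "(\<lambda>\<omega>. fst (incoming \<omega> (x,y))) \<in> vertex_draws Q \<xi> u \<rightarrow>\<^sub>M count_space UNIV"
    apply (subst incoming.simps)
    apply (cases "x \<le> 1")
     apply simp
    using measurable_compose[OF out[of "x-1" y], of fst "count_space UNIV"] less.prems by simp
  have b: "(\<lambda>\<omega>. snd (incoming \<omega> (x,y))) \<in> vertex_draws Q \<xi> u \<rightarrow>\<^sub>M count_space UNIV"
    apply (subst incoming.simps)
    apply (cases "y \<le> 1")
     apply simp
    using measurable_compose[OF out[of x "y-1"], of snd "count_space UNIV"] less.prems by simp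
  have "(\<lambda>\<omega>. (s, snd (incoming \<omega> (x, y)))) \<in> vertex_draws Q \<xi> u \<rightarrow>\<^sub>M count_space UNIV" for s :: bool
    by (rule measurable_compose[OF b, of "Pair s" "count_space UNIV"]) simp
  then have "(\<lambda>\<omega>. (fst (incoming \<omega> (x, y)), snd (incoming \<omega> (x, y)))) \<in>
      vertex_draws Q \<xi> u \<rightarrow>\<^sub>M count_space UNIV"
    by (rule measurable_compose_countable[where f="\<lambda>s \<omega>. (s, snd (incoming \<omega> (x, y)))", OF _ a])
  then show ?case by simp
qed

lemma measurable_configuration:
  "(\<lambda>\<omega>. restrict (incoming \<omega>) vertices)
    \<in> vertex_draws Q \<xi> u \<rightarrow>\<^sub>M (\<Pi>\<^sub>M v\<in>vertices. count_space UNIV)"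
  by (rule measurable_restrict) (auto simp: vertices_def intro: measurable_incoming)

text \<open>The law of the model, as a measure on configurations: functions assigning to each
  vertex the occupations of its (left, bottom) edges. Every edge is an incoming edge of
  exactly one vertex.\<close>

definition six_vertex ::
  "real \<Rightarrow> (nat \<Rightarrow> real) \<Rightarrow> (nat \<Rightarrow> real) \<Rightarrow> (nat \<times> nat \<Rightarrow> bool \<times> bool) measure" where
  "six_vertex Q \<xi> u =
     distr (vertex_draws Q \<xi> u) (\<Pi>\<^sub>M v\<in>vertices. count_space UNIV)
       (\<lambda>\<omega>. restrict (incoming \<omega>) vertices)"

lemma prob_space_six_vertex: "prob_space (six_vertex Q \<xi> u)"
proof -
  have "prob_space (vertex_draws Q \<xi> u)" unfolding vertex_draws_def
    by (rule prob_space_PiM) (auto intro: measure_pmf.prob_space_axioms)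
  then show ?thesis unfolding six_vertex_def by (rule prob_space.prob_space_distr[OF _ measurable_configuration])
qed

definition height_fn :: "(nat \<times> nat \<Rightarrow> bool \<times> bool) \<Rightarrow> nat \<Rightarrow> nat \<Rightarrow> nat" where
  "height_fn c x y = card {y'\<in>{1..y}. fst (c (x, y'))}"

lemma measurable_height_fn:
  assumes "x \<ge> 1"
  shows "(\<lambda>c. height_fn c x y) \<in> six_vertex Q \<xi> u \<rightarrow>\<^sub>M count_space UNIV"
proof -
  have 1: "(\<lambda>c. fst (c (x, y'))) \<in> six_vertex Q \<xi> u \<rightarrow>\<^sub>M count_space UNIV" if "y' \<ge> 1" for y'
    using measurable_compose[OF measurable_component_singleton[of "(x, y')" vertices
        "\<lambda>_. count_space UNIV"], of fst "count_space UNIV"] that assms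
    by (auto simp: six_vertex_def vertices_def)
  show ?thesis
    unfolding height_fn_def
  proof (rule measurable_card)
    fix k
    show "{c \<in> space (six_vertex Q \<xi> u). k \<in> {y' \<in> {1..y}. fst (c (x, y'))}} \<in> sets (six_vertex Q \<xi> u)"
      using 1[of k] by (cases "k \<in> {1..y}") (auto simp: pred_def)
  qed
qed

end

theory Submission
  imports Defs
begin

text \<open>
  Both sides are built up by local moves on the sign string. Replacing an adjacent pair $-+$ by
  $+-$ pushes the down-right path over one vertex $(x,y)$ and changes a single partition. On the
  six vertex side this draws one new vertex, whose randomness is independent of the heights along
  the old path. On the Hall--Littlewood side it is the skew Cauchy identity, refined by the lengths
  of the partitions: with $w = a_x b_y$, $p = \ell(\mu)$ and $q = \ell(\nu)$,
  $$(1-w) \sum_{\ell(\lambda)=k} P_{\lambda/\mu}(a_x) Q_{\lambda/\nu}(b_y) =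
    (1-tw) \sum_j R(j,p,q;k) \sum_{\ell(\kappa)=j} Q_{\mu/\kappa}(b_y) P_{\nu/\kappa}(a_x),$$
  where $R$ is the vertex law. The refined identity is proved by removing the first columns of
  $\mu$ and $\nu$: one column contributes a factor depending only on the lengths before and after
  the removal, so that the induction step is a finite computation (a Yang--Baxter equation).
  For the string $-\cdots-+\cdots+$ everything is deterministic.\<close>

section \<open>Removing the first column of a partition\<close>

text \<open>Columns are the right thing to strip because the weights see a partition only through
  its size and multiplicities. Removing the first column turns the multiplicity of i+1 into that of
  i, so all of P and Q survives except the factor at i = 1, where the multiplicity is the difference
  of the first two column lengths. The leftover powers of a and b combine into w or into a common
  factor a or b. If p and q differ by one, the induction step says that the weights of R out of each
  incoming state sum to one. If p = q, it is a pair of identities in t, w and a power of t given by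
  the number of ones; they are polynomial because 1-w is never divided out. The sums over lambda may
  be infinite, so their existence is proved along with the identity; the only series that is
  evaluated is geometric, for mu and nu empty. Intermediate strings may begin with a minus or end
  with a plus, so unnormalised masses are compared for all strings; the factor (1-tw)/(1-w) of a
  move is what the normalisation gains from the new pair +-.\<close>

definition add_column :: "nat \<Rightarrow> nat list \<Rightarrow> nat list" where
  "add_column k la = map Suc la @ replicate (k - length la) 1"

definition strip_column :: "nat list \<Rightarrow> nat list" where
  "strip_column la = map (\<lambda>x. x - 1) (filter (\<lambda>x. x > 1) la)"

lemma length_add_column: "length la \<le> k \<Longrightarrow> length (add_column k la) = k"
  by (simp add: add_column_def)

lemma sum_list_add_column: "length la \<le> k \<Longrightarrow> sum_list (add_column k la) = sum_list la + k"
proof -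
  assume *: "length la \<le> k"
  have "sum_list (map Suc la) = sum_list la + length la" by (induction la) auto
  then show ?thesis using * by (simp add: add_column_def sum_list_replicate)
qed

lemma add_column_in_partitions: "la \<in> partitions \<Longrightarrow> add_column k la \<in> partitions"
proof -
  assume *: "la \<in> partitions"
  have "sorted_wrt (\<ge>) (replicate n (1::nat))" for n by (induction n) auto
  then show ?thesis using * by (auto simp: partitions_def add_column_def sorted_wrt_append sorted_wrt_map)
qed

lemma strip_add_column: "la \<in> partitions \<Longrightarrow> strip_column (add_column k la) = la"
proof -
  assume "la \<in> partitions"
  then have "\<forall>x\<in>set la. 0 < x" by (auto simp: partitions_def)
  then show ?thesis
    by (auto simp: strip_column_def add_column_def filter_map o_def)
qed

lemma length_strip_column: "length (strip_column la) \<le> length la"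
  by (simp add: strip_column_def)

lemma add_strip_column: "la \<in> partitions \<Longrightarrow> add_column (length la) (strip_column la) = la"
proof (induction la)
  case (Cons x xs)
  then have x: "x > 0" "\<forall>y\<in>set xs. 0 < y \<and> y \<le> x" and xs: "xs \<in> partitions"
    by (auto simp: partitions_def)
  show ?case
  proof (cases "x > 1")
    case True
    then show ?thesis using Cons.IH[OF xs] by (simp add: strip_column_def add_column_def)
  next
    case False
    then have "x = 1" "\<forall>y\<in>set xs. y = 1" using x by fastforce+
    then have "xs = replicate (length xs) 1" and "filter (\<lambda>x. x > 1) xs = []"
      by (auto intro: replicate_eqI)
    then show ?thesis using \<open>x = 1\<close> by (simp add: strip_column_def add_column_def)
  qed
qed (simp add: strip_column_def add_column_def)

lemma strip_column_in_partitions: "la \<in> partitions \<Longrightarrow> strip_column la \<in> partitions"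
proof -
  assume *: "la \<in> partitions"
  then have "sorted_wrt (\<ge>) (filter (\<lambda>x. x > 1) la)"
    by (auto simp: partitions_def intro: sorted_wrt_filter)
  then have "sorted_wrt (\<lambda>x y. x - 1 \<ge> y - 1) (filter (\<lambda>x. x > 1) la)"
    by (rule sorted_wrt_mono_rel[rotated]) auto
  then show ?thesis by (auto simp: partitions_def strip_column_def sorted_wrt_map)
qed

lemma sum_list_strip_column_le: "sum_list (strip_column la) \<le> sum_list la"
  by (induction la) (auto simp: strip_column_def)

lemma sum_list_strip_column_less:
  "la \<in> partitions \<Longrightarrow> la \<noteq> [] \<Longrightarrow> sum_list (strip_column la) < sum_list la"
proof -
  assume *: "la \<in> partitions" "la \<noteq> []"
  have "sum_list la = sum_list (strip_column la) + length la"
    using sum_list_add_column[OF length_strip_column, of la] add_strip_column[OF *(1)] by simp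
  then show ?thesis using * by simp
qed

lemma bij_betw_add_column:
  "bij_betw (add_column k) {la \<in> partitions. length la \<le> k} {la \<in> partitions. length la = k}"
  by (rule bij_betw_byWitness[where f' = strip_column])
     (auto simp: strip_add_column add_strip_column strip_column_in_partitions
        add_column_in_partitions length_add_column length_strip_column)

lemma part_add_column:
  "length la \<le> k \<Longrightarrow> part (add_column k la) i = part la i + of_bool (i < k)"
  by (auto simp: part_def add_column_def nth_append)

lemma part_ge_length: "length la \<le> i \<Longrightarrow> part la i = 0"
  by (simp add: part_def)

text \<open>Row i grows by one exactly while i is below the new length, so the interlacing
  inequalities change only where one of the two shifts has stopped. The rows \<open>k\<close> of
  \<open>la\<close> and \<open>l\<close> of \<open>mu\<close> are empty, and there the inequalities
  force \<open>l \<le> k\<close> and \<open>k \<le> Suc l\<close>; in the other direction these two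
  bounds make the shifts compatible.\<close>

lemma interlaces_add_column:
  assumes "length la \<le> k" "length mu \<le> l"
  shows "add_column l mu \<prec>\<^sub>p add_column k la \<longleftrightarrow> mu \<prec>\<^sub>p la \<and> l \<le> k \<and> k \<le> Suc l"
proof
  assume *: "add_column l mu \<prec>\<^sub>p add_column k la"
  have 1: "part la i + of_bool (i < k) \<ge> part mu i + of_bool (i < l)" for i
    using * assms by (simp add: interlaces_def part_add_column)
  have 2: "part mu i + of_bool (i < l) \<ge> part la (Suc i) + of_bool (Suc i < k)" for i
    using * assms unfolding interlaces_def by (metis part_add_column)
  have lk: "l \<le> k" using 1[of k] assms(1) part_ge_length[of la k] by (auto simp: not_le split: if_splits)
  have kl: "k \<le> Suc l" using 2[of l] assms(2) part_ge_length[of mu l]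
    by (cases "Suc l < k") auto
  have "part la i \<ge> part mu i" for i
    using 1[of i] lk part_ge_length[of mu i] assms by (cases "i < l") auto
  moreover have "part mu i \<ge> part la (Suc i)" for i
    using 2[of i] lk kl part_ge_length[of la "Suc i"] assms by (cases "Suc i < k"; cases "i < l") auto
  ultimately show "mu \<prec>\<^sub>p la \<and> l \<le> k \<and> k \<le> Suc l" using lk kl by (auto simp: interlaces_def)
next
  assume *: "mu \<prec>\<^sub>p la \<and> l \<le> k \<and> k \<le> Suc l"
  then have "part la i + of_bool (i < k) \<ge> part mu i + of_bool (i < l)"
       "part mu i + of_bool (i < l) \<ge> part la (Suc i) + of_bool (Suc i < k)" for i
    by (cases "i < k"; cases "i < l"; cases "Suc i < k"; auto simp: interlaces_def le_SucI)+
  then show "add_column l mu \<prec>\<^sub>p add_column k la"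
    using assms by (simp add: interlaces_def part_add_column del: of_bool_eq)
qed

section \<open>Sizes and lengths under interlacing\<close>

lemma sum_list_eq_sum_part: "length la \<le> n \<Longrightarrow> sum_list la = (\<Sum>i<n. part la i)"
proof -
  assume *: "length la \<le> n"
  have "sum_list la = (\<Sum>i<length la. part la i)"
    by (simp add: sum_list_sum_nth part_def lessThan_atLeast0)
  also have "\<dots> = (\<Sum>i<n. part la i)"
    using * by (intro sum.mono_neutral_left) (auto simp: part_def)
  finally show ?thesis .
qed

lemma interlaces_sum_list_le: "mu \<prec>\<^sub>p la \<Longrightarrow> sum_list mu \<le> sum_list la"
  using sum_list_eq_sum_part[of mu "max (length mu) (length la)"]
    sum_list_eq_sum_part[of la "max (length mu) (length la)"]
  by (auto simp: interlaces_def intro!: sum_mono)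

text \<open>Positivity of the parts makes the length visible row by row: row i is nonzero iff i is
  below the length. The inequalities at the first empty rows then bound the lengths.\<close>

lemma interlaces_length:
  assumes "mu \<prec>\<^sub>p la" "mu \<in> partitions" "la \<in> partitions"
  shows "length mu \<le> length la" "length la \<le> Suc (length mu)"
proof -
  have la: "part la i > 0 \<longleftrightarrow> i < length la" and mu: "part mu i > 0 \<longleftrightarrow> i < length mu" for i
    using assms by (auto simp: partitions_def part_def)
  have "part mu (length la) \<le> part la (length la)" "part la (Suc (length mu)) \<le> part mu (length mu)"
    using assms by (auto simp: interlaces_def)
  with la[of "length la"] mu[of "length la"] la[of "Suc (length mu)"] mu[of "length mu"]
  show "length mu \<le> length la" "length la \<le> Suc (length mu)" by auto
qed

section \<open>Multiplicities and one-variable weights after adding a column\<close>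

lemma count_list_add_column_Suc: "i \<ge> 1 \<Longrightarrow> count_list (add_column k la) (Suc i) = count_list la i"
proof -
  assume "i \<ge> 1"
  then have "count_list (replicate n 1) (Suc i) = 0" for n by (induction n) auto
  moreover have "count_list (map Suc la) (Suc i) = count_list la i" by (induction la) auto
  ultimately show ?thesis by (simp add: add_column_def)
qed

lemma count_list_add_column_1:
  assumes "la \<in> partitions" shows "count_list (add_column k la) 1 = k - length la"
proof -
  have "count_list (replicate n (1::nat)) 1 = n" for n by (induction n) auto
  moreover have "\<forall>x\<in>set la. 0 < x" using assms by (auto simp: partitions_def)
  then have "count_list (map Suc la) 1 = 0" by (auto simp: count_list_0_iff)
  ultimately show ?thesis by (simp add: add_column_def)
qed

text \<open>The abstract form of the multiplicity shift, shared by P and Q: index i+1 after adding a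
  column plays the role of index i before, and index 1 contributes the only new factor.\<close>

lemma prod_column_split:
  fixes f :: "nat \<Rightarrow> 'a :: comm_monoid_mult"
  assumes "\<And>i. i \<ge> 1 \<Longrightarrow> D (Suc i) \<longleftrightarrow> D' i" and "\<And>i. i \<ge> 1 \<Longrightarrow> f (Suc i) = g i"
    and "finite {i. i \<ge> 1 \<and> D' i}"
  shows "prod f {i. i \<ge> 1 \<and> D i} = (if D 1 then f 1 else 1) * prod g {i. i \<ge> 1 \<and> D' i}"
proof -
  have eq: "{i. i \<ge> 1 \<and> D i} = (if D 1 then {1} else {}) \<union> Suc ` {i. i \<ge> 1 \<and> D' i}"
  proof (intro set_eqI iffI)
    fix i assume i: "i \<in> {i. i \<ge> 1 \<and> D i}"
    show "i \<in> (if D 1 then {1} else {}) \<union> Suc ` {i. i \<ge> 1 \<and> D' i}"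
    proof (cases "i = 1")
      case False
      then obtain j where "i = Suc j" "j \<ge> 1" using i by (cases i) auto
      then show ?thesis using i assms(1)[of j] by auto
    qed (use i in auto)
  qed (use assms(1) in \<open>auto split: if_splits\<close>)
  have "prod f {i. i \<ge> 1 \<and> D i} = prod f (if D 1 then {1} else {}) * prod f (Suc ` {i. i \<ge> 1 \<and> D' i})"
    unfolding eq using assms(3) by (intro prod.union_disjoint) auto
  also have "prod f (Suc ` {i. i \<ge> 1 \<and> D' i}) = prod g {i. i \<ge> 1 \<and> D' i}"
    using assms(2) by (subst prod.reindex) (auto intro!: prod.cong)
  finally show ?thesis by auto
qed

lemma finite_count_list_pos: "finite {i. count_list la i > 0}"
  by (rule finite_subset[OF _ finite_set[of la]]) (auto simp: count_list_0_iff intro: ccontr)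

text \<open>The extended partitions have \<open>k - length la\<close> and
  \<open>l - length mu\<close> ones, which decides the new factor at index 1. Adding columns of
  lengths \<open>k\<close> and \<open>l\<close> raises the size difference by \<open>k - l\<close>,
  hence the power of \<open>a\<close>.\<close>

lemma HL_P_add_column:
  assumes "la \<in> partitions" "mu \<in> partitions" "length la \<le> k" "length mu \<le> l"
  shows "HL_P t (add_column k la) (add_column l mu) a =
    (if l \<le> k \<and> k \<le> Suc l
     then a ^ (k - l) * (if k - length la + 1 = l - length mu then 1 - t ^ (l - length mu) else 1) *
       HL_P t la mu a else 0)"
proof -
  have fin: "finite {i. i \<ge> 1 \<and> count_list la i + 1 = count_list mu i}"
    by (rule finite_subset[OF _ finite_count_list_pos[of mu]]) auto
  have *: "(\<Prod>i\<in>{i. i \<ge> 1 \<and> count_list (add_column k la) i + 1 = count_list (add_column l mu) i}.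
          1 - t ^ count_list (add_column l mu) i) =
     (if k - length la + 1 = l - length mu then 1 - t ^ (l - length mu) else 1) *
     (\<Prod>i\<in>{i. i \<ge> 1 \<and> count_list la i + 1 = count_list mu i}. 1 - t ^ count_list mu i)"
    using prod_column_split[of "\<lambda>i. count_list (add_column k la) i + 1 = count_list (add_column l mu) i"
        "\<lambda>i. count_list la i + 1 = count_list mu i" "\<lambda>i. 1 - t ^ count_list (add_column l mu) i"
        "\<lambda>i. 1 - t ^ count_list mu i"] assms fin
    by (simp only: count_list_add_column_Suc count_list_add_column_1)
  \<comment> \<open>The exponents are truncated differences; they split additively because
    interlacing gives \<open>sum_list mu \<le> sum_list la\<close>.\<close>
  have "x ^ (sum_list (add_column k la) - sum_list (add_column l mu)) =
      x ^ (k - l) * x ^ (sum_list la - sum_list mu)" if "mu \<prec>\<^sub>p la" "l \<le> k" for x :: real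
    using interlaces_sum_list_le[OF that(1)] that(2) assms
    by (simp add: sum_list_add_column add_ac flip: power_add)
  then show ?thesis
    unfolding HL_P_def interlaces_add_column[OF assms(3,4)] * by auto
qed

lemma HL_Q_add_column:
  assumes "la \<in> partitions" "mu \<in> partitions" "length la \<le> k" "length mu \<le> l"
  shows "HL_Q t (add_column k la) (add_column l mu) b =
    (if l \<le> k \<and> k \<le> Suc l
     then b ^ (k - l) * (if k - length la = l - length mu + 1 then 1 - t ^ (k - length la) else 1) *
       HL_Q t la mu b else 0)"
proof -
  have fin: "finite {i. i \<ge> 1 \<and> count_list la i = count_list mu i + 1}"
    by (rule finite_subset[OF _ finite_count_list_pos[of la]]) auto
  have *: "(\<Prod>i\<in>{i. i \<ge> 1 \<and> count_list (add_column k la) i = count_list (add_column l mu) i + 1}.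
          1 - t ^ count_list (add_column k la) i) =
     (if k - length la = l - length mu + 1 then 1 - t ^ (k - length la) else 1) *
     (\<Prod>i\<in>{i. i \<ge> 1 \<and> count_list la i = count_list mu i + 1}. 1 - t ^ count_list la i)"
    using prod_column_split[of "\<lambda>i. count_list (add_column k la) i = count_list (add_column l mu) i + 1"
        "\<lambda>i. count_list la i = count_list mu i + 1" "\<lambda>i. 1 - t ^ count_list (add_column k la) i"
        "\<lambda>i. 1 - t ^ count_list la i"] assms fin
    by (simp only: count_list_add_column_Suc count_list_add_column_1)
  have "x ^ (sum_list (add_column k la) - sum_list (add_column l mu)) =
      x ^ (k - l) * x ^ (sum_list la - sum_list mu)" if "mu \<prec>\<^sub>p la" "l \<le> k" for x :: real
    using interlaces_sum_list_le[OF that(1)] that(2) assms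
    by (simp add: sum_list_add_column add_ac flip: power_add)
  then show ?thesis
    unfolding HL_Q_def interlaces_add_column[OF assms(3,4)] * by auto
qed

lemma HL_P_eq_0: "mu \<in> partitions \<Longrightarrow> la \<in> partitions \<Longrightarrow>
    \<not> (length mu \<le> length la \<and> length la \<le> Suc (length mu)) \<Longrightarrow> HL_P t la mu a = 0"
  using interlaces_length by (auto simp: HL_P_def)

lemma HL_Q_eq_0: "mu \<in> partitions \<Longrightarrow> la \<in> partitions \<Longrightarrow>
    \<not> (length mu \<le> length la \<and> length la \<le> Suc (length mu)) \<Longrightarrow> HL_Q t la mu b = 0"
  using interlaces_length by (auto simp: HL_Q_def)

lemma HL_P_nonneg: "0 < t \<Longrightarrow> t < 1 \<Longrightarrow> 0 \<le> a \<Longrightarrow> HL_P t la mu a \<ge> 0"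
  by (auto simp: HL_P_def power_le_one simp del: power_Suc intro!: mult_nonneg_nonneg prod_nonneg)

lemma HL_Q_nonneg: "0 < t \<Longrightarrow> t < 1 \<Longrightarrow> 0 \<le> b \<Longrightarrow> HL_Q t la mu b \<ge> 0"
  by (auto simp: HL_Q_def power_le_one simp del: power_Suc intro!: mult_nonneg_nonneg prod_nonneg)

section \<open>The refined skew Cauchy identity\<close>

definition partitions_len :: "int \<Rightarrow> nat list set" where
  "partitions_len k = {la \<in> partitions. int (length la) = k}"

definition up_weight :: "real \<Rightarrow> real \<Rightarrow> real \<Rightarrow> nat list \<Rightarrow> nat list \<Rightarrow> nat list \<Rightarrow> real" where
  "up_weight t a b mu nu la = HL_P t la mu a * HL_Q t la nu b"

definition down_weight :: "real \<Rightarrow> real \<Rightarrow> real \<Rightarrow> nat list \<Rightarrow> nat list \<Rightarrow> nat list \<Rightarrow> real" where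
  "down_weight t a b mu nu ka = HL_Q t mu ka b * HL_P t nu ka a"

lemma has_sum_partitions_add_column:
  assumes "((\<lambda>la. F (add_column n la)) has_sum s) {la \<in> partitions. length la \<le> n}"
  shows "(F has_sum s) (partitions_len (int n))"
  using assms has_sum_reindex_bij_betw[OF bij_betw_add_column, of F n s]
  by (simp add: partitions_len_def)

text \<open>Every partition of length \<open>n\<close> is uniquely a column of length
  \<open>n\<close> added to a partition of length at most \<open>n\<close>. Interlacing with
  \<open>mu\<close> leaves only the stripped lengths \<open>p'\<close> and \<open>p' + 1\<close>,
  and on each of these the extra factor is constant, so the sum becomes a combination of two values
  of \<open>A\<close>.\<close>

lemma up_sum_add_column:
  assumes part: "mu \<in> partitions" "nu \<in> partitions" and len: "length mu = p'" "length nu = q'"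
    and le: "p' \<le> p" "q' \<le> q" and n: "p \<le> n" "n \<le> Suc p" "q \<le> n" "n \<le> Suc q"
    and A: "\<And>k. (up_weight t a b mu nu has_sum A k) (partitions_len k)"
  shows "(up_weight t a b (add_column p mu) (add_column q nu) has_sum
     a ^ (n - p) * b ^ (n - q) *
      ((if n = Suc q \<and> q' = p' then 1 - t ^ (n - p') else 1) * A (int p') +
       (if n = p then 1 - t ^ (p - p') else 1) * (if n = Suc q \<and> q' = Suc p' then 1 - t ^ (n - Suc p') else 1)
         * A (int p' + 1))) (partitions_len (int n))"
proof (rule has_sum_partitions_add_column)
  \<comment> \<open>The factor at index 1 coming from P times the one coming from Q, as a function
    of the stripped length \<open>l\<close>.\<close>
  define al where "al l = (if n = p \<and> l = Suc p' then 1 - t ^ (p - p') else 1) *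
    (if n = Suc q \<and> l = q' then 1 - t ^ (n - l) else 1)" for l
  define c where "c = a ^ (n - p) * b ^ (n - q)"
  have 1: "((\<lambda>la. c * al (length la) * up_weight t a b mu nu la) has_sum c * al l * A (int l))
    (partitions_len (int l))" for l
    using has_sum_cmult_right[OF A[of "int l"], of "c * al l"]
    by (subst has_sum_cong[where g = "\<lambda>la. c * al l * up_weight t a b mu nu la"])
       (auto simp: partitions_len_def mult_ac)
  have 2: "((\<lambda>la. c * al (length la) * up_weight t a b mu nu la) has_sum
      (c * al p' * A (int p') + c * al (Suc p') * A (int (Suc p'))))
      (partitions_len (int p') \<union> partitions_len (int (Suc p')))"
    by (intro has_sum_Un_disjoint 1) (auto simp: partitions_len_def)
  have 3: "c * al p' * A (int p') + c * al (Suc p') * A (int (Suc p')) =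
    a ^ (n - p) * b ^ (n - q) *
      ((if n = Suc q \<and> q' = p' then 1 - t ^ (n - p') else 1) * A (int p') +
       (if n = p then 1 - t ^ (p - p') else 1) * (if n = Suc q \<and> q' = Suc p' then 1 - t ^ (n - Suc p') else 1)
         * A (int p' + 1))"
    by (auto simp: c_def al_def algebra_simps)
  show "((\<lambda>la. up_weight t a b (add_column p mu) (add_column q nu) (add_column n la)) has_sum
     a ^ (n - p) * b ^ (n - q) *
      ((if n = Suc q \<and> q' = p' then 1 - t ^ (n - p') else 1) * A (int p') +
       (if n = p then 1 - t ^ (p - p') else 1) * (if n = Suc q \<and> q' = Suc p' then 1 - t ^ (n - Suc p') else 1)
         * A (int p' + 1))) {la \<in> partitions. length la \<le> n}"
  proof (rule iffD2[OF has_sum_cong_neutral 2[unfolded 3]])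
    \<comment> \<open>A stripped length above \<open>n\<close> can occur in the union only if
      \<open>n = p = p'\<close>; there the factor is \<open>1 - t ^ 0 = 0\<close>, so the formula
      stays valid at this boundary.\<close>
    fix la assume "la \<in> partitions_len (int p') \<union> partitions_len (int (Suc p')) - {la \<in> partitions. length la \<le> n}"
    then have "length la = Suc p'" "n = p" "p = p'" using n le by (auto simp: partitions_len_def)
    then show "c * al (length la) * up_weight t a b mu nu la = 0" by (simp add: al_def)
  next
    fix la assume *: "la \<in> {la \<in> partitions. length la \<le> n} - (partitions_len (int p') \<union> partitions_len (int (Suc p')))"
    then have "HL_P t la mu a = 0" using part len by (intro HL_P_eq_0) (auto simp: partitions_len_def)
    then show "up_weight t a b (add_column p mu) (add_column q nu) (add_column n la) = 0"
      using * part len le by (simp add: up_weight_def HL_P_add_column)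
  next
    fix la assume *: "la \<in> {la \<in> partitions. length la \<le> n} \<inter> (partitions_len (int p') \<union> partitions_len (int (Suc p')))"
    then have la: "la \<in> partitions" "length la \<le> n" "length la = p' \<or> length la = Suc p'"
      by (auto simp: partitions_len_def)
    show "up_weight t a b (add_column p mu) (add_column q nu) (add_column n la) =
      c * al (length la) * up_weight t a b mu nu la"
    \<comment> \<open>The index-1 condition of Q simplifies to \<open>n = Suc q\<close> and
      \<open>length la = q'\<close> only for lengths compatible with \<open>nu\<close>. For all
      others both sides vanish.\<close>
    proof (cases "length la = q' \<or> length la = Suc q'")
      case True
      have e1: "n - length la + 1 = p - p' \<longleftrightarrow> n = p \<and> length la = Suc p'" using la(2,3) n le by auto
      have e2: "n - length la = q - q' + 1 \<longleftrightarrow> n = Suc q \<and> length la = q'" using la(2) True n le by auto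
      show ?thesis using la part len le n
        by (simp add: up_weight_def HL_P_add_column HL_Q_add_column e1[simplified] e2[simplified] al_def c_def)
    next
      case False
      then have "HL_Q t la nu b = 0" using part len la by (intro HL_Q_eq_0) auto
      then show ?thesis using la part len le by (simp add: up_weight_def HL_Q_add_column)
    qed
  qed
qed

text \<open>The counterpart for partitions lying below both \<open>mu\<close> and \<open>nu\<close>:
  the stripped length is now \<open>p'\<close> or \<open>p' - 1\<close>. The index is an integer
  because \<open>p' - 1\<close> may be negative, in which case the corresponding set of partitions
  is empty.\<close>

lemma down_sum_add_column:
  assumes part: "mu \<in> partitions" "nu \<in> partitions" and len: "length mu = p'" "length nu = q'"
    and le: "p' \<le> p" "q' \<le> q" and j: "j \<le> p" "p \<le> Suc j" "j \<le> q" "q \<le> Suc j"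
    and B: "\<And>k. (down_weight t a b mu nu has_sum B k) (partitions_len k)"
  shows "(down_weight t a b (add_column p mu) (add_column q nu) has_sum
     b ^ (p - j) * a ^ (q - j) *
      ((if p = Suc j then 1 - t ^ (p - p') else 1) * (if q = j \<and> q' = Suc p' then 1 - t ^ (j - p') else 1)
         * B (int p') +
       (if q = j \<and> q' = p' then 1 - t ^ (Suc j - p') else 1) * B (int p' - 1))) (partitions_len (int j))"
proof (rule has_sum_partitions_add_column)
  define be where "be l = (if p = Suc j \<and> l = int p' then 1 - t ^ (p - p') else 1) *
    (if q = j \<and> int q' = l + 1 then 1 - t ^ nat (int j - l) else 1)" for l
  define c where "c = b ^ (p - j) * a ^ (q - j)"
  have 1: "((\<lambda>la. c * be (int (length la)) * down_weight t a b mu nu la) has_sum c * be l * B l)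
    (partitions_len l)" for l
    using has_sum_cmult_right[OF B[of l], of "c * be l"]
    by (subst has_sum_cong[where g = "\<lambda>la. c * be l * down_weight t a b mu nu la"])
       (auto simp: partitions_len_def mult_ac)
  have 2: "((\<lambda>la. c * be (int (length la)) * down_weight t a b mu nu la) has_sum
      (c * be (int p') * B (int p') + c * be (int p' - 1) * B (int p' - 1)))
      (partitions_len (int p') \<union> partitions_len (int p' - 1))"
    by (intro has_sum_Un_disjoint 1) (auto simp: partitions_len_def)
  have "nat (int j - (int p' - 1)) = Suc j - p'" "nat (int j - int p') = j - p'" by simp_all
  then have 3: "c * be (int p') * B (int p') + c * be (int p' - 1) * B (int p' - 1) =
     b ^ (p - j) * a ^ (q - j) *
      ((if p = Suc j then 1 - t ^ (p - p') else 1) * (if q = j \<and> q' = Suc p' then 1 - t ^ (j - p') else 1)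
         * B (int p') +
       (if q = j \<and> q' = p' then 1 - t ^ (Suc j - p') else 1) * B (int p' - 1))"
    by (auto simp: c_def be_def algebra_simps nat_diff_distrib)
  show "((\<lambda>la. down_weight t a b (add_column p mu) (add_column q nu) (add_column j la)) has_sum
     b ^ (p - j) * a ^ (q - j) *
      ((if p = Suc j then 1 - t ^ (p - p') else 1) * (if q = j \<and> q' = Suc p' then 1 - t ^ (j - p') else 1)
         * B (int p') +
       (if q = j \<and> q' = p' then 1 - t ^ (Suc j - p') else 1) * B (int p' - 1)))
      {la \<in> partitions. length la \<le> j}"
  proof (rule iffD2[OF has_sum_cong_neutral 2[unfolded 3]])
    \<comment> \<open>The boundary case is \<open>p = p' = Suc j\<close>, where a stripped partition
      of length \<open>p'\<close> would not fit below a column of length \<open>j\<close>; again the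
      factor is \<open>1 - t ^ 0 = 0\<close>.\<close>
    fix la assume "la \<in> partitions_len (int p') \<union> partitions_len (int p' - 1) - {la \<in> partitions. length la \<le> j}"
    then have "length la = p'" "p = Suc j" "p = p'" using j le by (auto simp: partitions_len_def)
    then show "c * be (int (length la)) * down_weight t a b mu nu la = 0" by (simp add: be_def)
  next
    fix la assume *: "la \<in> {la \<in> partitions. length la \<le> j} - (partitions_len (int p') \<union> partitions_len (int p' - 1))"
    then have "HL_Q t mu la b = 0" using part len by (intro HL_Q_eq_0) (auto simp: partitions_len_def)
    then show "down_weight t a b (add_column p mu) (add_column q nu) (add_column j la) = 0"
      using * part len le by (simp add: down_weight_def HL_Q_add_column)
  next
    fix la assume *: "la \<in> {la \<in> partitions. length la \<le> j} \<inter> (partitions_len (int p') \<union> partitions_len (int p' - 1))"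
    then have la: "la \<in> partitions" "length la \<le> j" "p' = length la \<or> p' = Suc (length la)"
      by (auto simp: partitions_len_def)
    show "down_weight t a b (add_column p mu) (add_column q nu) (add_column j la) =
      c * be (int (length la)) * down_weight t a b mu nu la"
    proof (cases "q' = length la \<or> q' = Suc (length la)")
      case True
      have e1: "q - q' + 1 = j - length la \<longleftrightarrow> q = j \<and> q' = Suc (length la)" using la(2) True j le by auto
      have e2: "p - p' = j - length la + 1 \<longleftrightarrow> p = Suc j \<and> length la = p'" using la(2,3) j le by auto
      show ?thesis using la part len le j
        by (simp add: down_weight_def HL_P_add_column HL_Q_add_column e1[simplified] e2[simplified] be_def c_def
             nat_diff_distrib nat_int_add)
    next
      case False
      then have "HL_P t nu la a = 0" using part len la by (intro HL_P_eq_0) auto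
      then show ?thesis using la part len le by (simp add: down_weight_def HL_P_add_column)
    qed
  qed
qed

text \<open>\<open>A k\<close> stands for the sum of the up weights over partitions of length \<open>k\<close>, and \<open>B j\<close> for the
  sum of the down weights over partitions of length \<open>j\<close>; lengths are integers, so that
  \<open>B (p - 1)\<close> is 0 rather than \<open>B 0\<close> when \<open>p = 0\<close>.\<close>

definition exchange_rel :: "real \<Rightarrow> real \<Rightarrow> int \<Rightarrow> int \<Rightarrow> (int \<Rightarrow> real) \<Rightarrow> (int \<Rightarrow> real) \<Rightarrow> bool" where
  "exchange_rel t w p q A B \<longleftrightarrow>
    (\<forall>k. \<not> (p \<le> k \<and> k \<le> p + 1 \<and> q \<le> k \<and> k \<le> q + 1) \<longrightarrow> A k = 0) \<and>
    (\<forall>j. \<not> (0 \<le> j \<and> j \<le> p \<and> p \<le> j + 1 \<and> j \<le> q \<and> q \<le> j + 1) \<longrightarrow> B j = 0) \<and>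
    (p = q \<longrightarrow> (1 - w) * A p = (1 - w) * B p + (1 - t) * B (p - 1) \<and>
               (1 - w) * A (p + 1) = (1 - t) * w * B p + t * (1 - w) * B (p - 1)) \<and>
    (q = p + 1 \<longrightarrow> (1 - w) * A q = (1 - t * w) * B p) \<and>
    (p = q + 1 \<longrightarrow> (1 - w) * A p = (1 - t * w) * B q)"

text \<open>The Yang-Baxter step, with partitions gone: only the lengths and the values of
  \<open>A'\<close> and \<open>B'\<close> remain. The four cases \<open>cs'\<close> are the possible
  differences of the stripped lengths, and the support conditions remove the terms that cannot occur
  in each.\<close>

lemma exchange_rel_add_column:
  fixes a b t :: real and p q p' q' :: nat
  assumes rel: "exchange_rel t (a * b) (int p') (int q') A' B'"
    and le: "p' \<le> p" "q' \<le> q"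
    and A: "\<And>n. p \<le> n \<Longrightarrow> n \<le> Suc p \<Longrightarrow> q \<le> n \<Longrightarrow> n \<le> Suc q \<Longrightarrow> A (int n) =
      a ^ (n - p) * b ^ (n - q) *
      ((if n = Suc q \<and> q' = p' then 1 - t ^ (n - p') else 1) * A' (int p') +
       (if n = p then 1 - t ^ (p - p') else 1) * (if n = Suc q \<and> q' = Suc p' then 1 - t ^ (n - Suc p') else 1)
         * A' (int p' + 1))"
    and A0: "\<And>k. \<not> (int p \<le> k \<and> k \<le> int p + 1 \<and> int q \<le> k \<and> k \<le> int q + 1) \<Longrightarrow> A k = 0"
    and B: "\<And>j. j \<le> p \<Longrightarrow> p \<le> Suc j \<Longrightarrow> j \<le> q \<Longrightarrow> q \<le> Suc j \<Longrightarrow> B (int j) =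
      b ^ (p - j) * a ^ (q - j) *
      ((if p = Suc j then 1 - t ^ (p - p') else 1) * (if q = j \<and> q' = Suc p' then 1 - t ^ (j - p') else 1)
         * B' (int p') +
       (if q = j \<and> q' = p' then 1 - t ^ (Suc j - p') else 1) * B' (int p' - 1))"
    and B0: "\<And>j. \<not> (0 \<le> j \<and> j \<le> int p \<and> int p \<le> j + 1 \<and> j \<le> int q \<and> int q \<le> j + 1) \<Longrightarrow> B j = 0"
  shows "exchange_rel t (a * b) (int p) (int q) A B"
proof -
  have A'0: "A' k = 0" if "\<not> (int p' \<le> k \<and> k \<le> int p' + 1 \<and> int q' \<le> k \<and> k \<le> int q' + 1)" for k
    using rel that unfolding exchange_rel_def by blast
  have B'0: "B' j = 0"
    if "\<not> (0 \<le> j \<and> j \<le> int p' \<and> int p' \<le> j + 1 \<and> j \<le> int q' \<and> int q' \<le> j + 1)" for j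
    using rel that unfolding exchange_rel_def by blast
  have R0: "(1 - a * b) * A' (int p') = (1 - a * b) * B' (int p') + (1 - t) * B' (int p' - 1)"
    "(1 - a * b) * A' (int p' + 1) = (1 - t) * (a * b) * B' (int p') + t * (1 - a * b) * B' (int p' - 1)"
    if "q' = p'" using rel that unfolding exchange_rel_def by auto
  have R1: "(1 - a * b) * A' (int p' + 1) = (1 - t * (a * b)) * B' (int p')" if "q' = Suc p'"
    using rel that unfolding exchange_rel_def by (auto simp: add_ac)
  have R2: "(1 - a * b) * A' (int p') = (1 - t * (a * b)) * B' (int p' - 1)" if "p' = Suc q'"
    using rel that unfolding exchange_rel_def by auto
  consider "q' = p'" | "q' = Suc p'" | "p' = Suc q'" | "q' > Suc p' \<or> p' > Suc q'" by linarith
  note cs' = this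
  have E0: "(1 - a * b) * A (int p) = (1 - a * b) * B (int p) + (1 - t) * B (int p - 1) \<and>
     (1 - a * b) * A (int p + 1) = (1 - t) * (a * b) * B (int p) + t * (1 - a * b) * B (int p - 1)" if pq: "q = p"
  proof (cases p)
    \<comment> \<open>Here \<open>p' \<le> p\<close> forces all lengths to be 0, and
      \<open>B (int p - 1)\<close> vanishes by its support instead of being given by the column
      formula. The factor \<open>1 - t\<close> comes from a single new part equal to 1.\<close>
    case 0
    then have p'q': "q' = p'" and z: "B (int p - 1) = 0" "B' (int p' - 1) = 0" using B0 B'0 le pq by auto
    have F: "A (int p) = A' (int p')" "B (int p) = B' (int p')"
      "A (int p + 1) = a * b * ((1 - t) * A' (int p') + A' (int p' + 1))"
      using 0 pq le A[of 0] A[of 1] B[of 0] z by simp_all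
    note R = R0[OF p'q']
    have "(1 - a * b) * A (int p) = (1 - a * b) * B (int p) + (1 - t) * B (int p - 1)"
      using F z R by simp
    moreover have "(1 - a * b) * A (int p + 1) = (1 - t) * (a * b) * B (int p) + t * (1 - a * b) * B (int p - 1)"
    proof -
      have "(1 - a * b) * A (int p + 1) =
          a * b * ((1 - t) * ((1 - a * b) * A' (int p')) + (1 - a * b) * A' (int p' + 1))"
        unfolding F(3) by algebra
      also have "\<dots> = (1 - t) * (a * b) * B' (int p')"
        unfolding R z by (simp add: algebra_simps)
      finally show ?thesis using F z by simp
    qed
    ultimately show ?thesis by blast
  next
    case (Suc r)
    \<comment> \<open>\<open>V\<close> is \<open>1 - t ^ (Suc p - p')\<close> written through
      \<open>T\<close>. Expressed this way the identities hold for arbitrary \<open>T\<close>, so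
      the power of \<open>t\<close> can be treated as an indeterminate.\<close>
    define T where "T = 1 - t ^ (p - p')"
    define V where "V = 1 - t * (1 - T)"
    have V: "1 - t ^ (Suc p - p') = V" using le(1) by (simp add: V_def T_def Suc_diff_le)
    have r: "int p - 1 = int r" using Suc by simp
    have F: "A (int p) = A' (int p') + T * A' (int p' + 1)"
      "A (int p + 1) = a * b * ((if q' = p' then V else 1) * A' (int p') +
         (if q' = Suc p' then T else 1) * A' (int p' + 1))"
      "B (int p) = (if q' = Suc p' then T else 1) * B' (int p') + (if q' = p' then V else 1) * B' (int p' - 1)"
      "B (int p - 1) = a * b * (T * B' (int p') + B' (int p' - 1))"
      using A[of p] A[of "Suc p"] B[of p] B[of r] pq Suc
      by (simp_all add: V[symmetric] T_def r add_ac)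
    show ?thesis
    proof (cases rule: cs')
      case 1
      have "A (int p + 1) = a * b * (V * A' (int p') + A' (int p' + 1))"
        "B (int p) = B' (int p') + V * B' (int p' - 1)"
        using F(2,3) 1 by simp_all
      note F' = F(1) this F(4) V_def R0[OF 1]
      have "(1 - a * b) * A (int p) = (1 - a * b) * B (int p) + (1 - t) * B (int p - 1)"
        using F' by algebra
      moreover have "(1 - a * b) * A (int p + 1) =
          (1 - t) * (a * b) * B (int p) + t * (1 - a * b) * B (int p - 1)"
        using F' by algebra
      ultimately show ?thesis by blast
    next
      case 2
      then have "A' (int p') = 0" "B' (int p' - 1) = 0" using A'0 B'0 by auto
      then have F': "A (int p) = T * A' (int p' + 1)" "A (int p + 1) = a * b * (T * A' (int p' + 1))"
        "B (int p) = T * B' (int p')" "B (int p - 1) = a * b * (T * B' (int p'))"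
        using F 2 by simp_all
      show ?thesis unfolding F' using R1[OF 2] by (intro conjI) algebra+
    next
      case 3
      then have "A' (int p' + 1) = 0" "B' (int p') = 0" "q' \<noteq> p'" "q' \<noteq> Suc p'" using A'0 B'0 by auto
      then have F': "A (int p) = A' (int p')" "A (int p + 1) = a * b * A' (int p')"
        "B (int p) = B' (int p' - 1)" "B (int p - 1) = a * b * B' (int p' - 1)"
        using F by simp_all
      show ?thesis unfolding F' using R2[OF 3] by (intro conjI) algebra+
    next
      case 4
      then have "A' (int p' + 1) = 0" "B' (int p') = 0" "A' (int p') = 0" "B' (int p' - 1) = 0"
        using A'0 B'0 by auto
      then show ?thesis using F by simp
    qed
  qed
  have E1: "(1 - a * b) * A (int q) = (1 - t * (a * b)) * B (int p)" if pq: "q = Suc p"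
  proof -
    \<comment> \<open>No index-1 factor appears when \<open>q = Suc p\<close>. In the case
      \<open>q' = p'\<close> the two relations for \<open>A'\<close> are simply added: (1-w) +
      (1-t)w and (1-t) + t(1-w) both equal 1-tw, which is the stochasticity of the vertex
      weights.\<close>
    have F: "A (int q) = a * (A' (int p') + A' (int p' + 1))"
      "B (int p) = a * (B' (int p') + B' (int p' - 1))"
      using A[of q] B[of p] pq by simp_all
    show ?thesis
    proof (cases rule: cs')
      case 1
      show ?thesis using F R0[OF 1] by algebra
    next
      case 2
      then have "A' (int p') = 0" "B' (int p' - 1) = 0" using A'0 B'0 by auto
      then show ?thesis using F R1[OF 2] by algebra
    next
      case 3
      then have "A' (int p' + 1) = 0" "B' (int p') = 0" using A'0 B'0 by auto
      then show ?thesis using F R2[OF 3] by algebra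
    next
      case 4
      then have "A' (int p' + 1) = 0" "B' (int p') = 0" "A' (int p') = 0" "B' (int p' - 1) = 0"
        using A'0 B'0 by auto
      then show ?thesis using F by simp
    qed
  qed
  have E2: "(1 - a * b) * A (int p) = (1 - t * (a * b)) * B (int q)" if pq: "p = Suc q"
  proof -
    define T where "T = 1 - t ^ (p - p')"
    define U where "U = (if q' = Suc p' then 1 - t ^ (q - p') else 1)"
    have F: "A (int p) = b * ((if q' = p' then T else 1) * A' (int p') + T * U * A' (int p' + 1))"
      "B (int q) = b * (T * U * B' (int p') + (if q' = p' then T else 1) * B' (int p' - 1))"
      using A[of p] B[of q] pq by (simp_all add: T_def U_def)
    show ?thesis
    proof (cases rule: cs')
      case 1
      \<comment> \<open>The index-1 factor is the same in all four terms, so it comes out in front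
        and stochasticity finishes as in the case \<open>q = Suc p\<close>.\<close>
      then have "A (int p) = b * T * (A' (int p') + A' (int p' + 1))"
        "B (int q) = b * T * (B' (int p') + B' (int p' - 1))"
        using F by (simp_all add: U_def algebra_simps)
      then show ?thesis using R0[OF 1] by algebra
    next
      case 2
      then have "A' (int p') = 0" "B' (int p' - 1) = 0" using A'0 B'0 by auto
      then show ?thesis using F R1[OF 2] by algebra
    next
      case 3
      then have "A' (int p' + 1) = 0" "B' (int p') = 0" "q' \<noteq> p'" using A'0 B'0 by auto
      then have "A (int p) = b * A' (int p')" "B (int q) = b * B' (int p' - 1)" using F by simp_all
      then show ?thesis using R2[OF 3] by algebra
    next
      case 4
      then have "A' (int p' + 1) = 0" "B' (int p') = 0" "A' (int p') = 0" "B' (int p' - 1) = 0"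
        using A'0 B'0 by auto
      then show ?thesis using F by simp
    qed
  qed
  show ?thesis
    unfolding exchange_rel_def
  proof (intro conjI allI impI)
    show "A k = 0" if "\<not> (int p \<le> k \<and> k \<le> int p + 1 \<and> int q \<le> k \<and> k \<le> int q + 1)" for k
      using that by (rule A0)
    show "B j = 0"
      if "\<not> (0 \<le> j \<and> j \<le> int p \<and> int p \<le> j + 1 \<and> j \<le> int q \<and> int q \<le> j + 1)" for j
      using that by (rule B0)
  qed (use E0 E1 E2 in auto)
qed

section \<open>The base of the column induction\<close>

lemma HL_P_Nil_Nil: "HL_P t [] [] a = 1"
  by (simp add: HL_P_def interlaces_def part_def)

lemma HL_Q_Nil_Nil: "HL_Q t [] [] b = 1"
  by (simp add: HL_Q_def interlaces_def part_def)

lemma HL_P_single_Nil: "HL_P t [n] [] a = a ^ n"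
  by (simp add: HL_P_def interlaces_def part_def)

lemma HL_Q_single_Nil: "n > 0 \<Longrightarrow> HL_Q t [n] [] b = b ^ n * (1 - t)"
proof -
  assume "n > 0"
  then have "{i. 1 \<le> i \<and> count_list [n] i = count_list [] i + 1} = {n}" by auto
  then show ?thesis by (simp add: HL_Q_def interlaces_def part_def)
qed

lemma Nil_in_partitions: "[] \<in> partitions"
  by (simp add: partitions_def)

text \<open>Above the empty partition there are only single rows. The row of length n+1 contributes
  (1-t) times the power n+1 of ab, a geometric series summing to the value \<open>A 1\<close>; below
  there is only the empty partition itself.\<close>

lemma exchange_rel_Nil:
  fixes a b t :: real
  assumes w: "0 \<le> a * b" "a * b < 1"
  shows "\<exists>A B. (\<forall>k. (up_weight t a b [] [] has_sum A k) (partitions_len k)) \<and>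
     (\<forall>j. (down_weight t a b [] [] has_sum B j) (partitions_len j)) \<and>
     exchange_rel t (a * b) 0 0 A B"
proof -
  define A where "A k = (if k = 0 then 1 else if k = 1 then (1 - t) * (a * b) / (1 - a * b) else 0)" for k :: int
  define B where "B j = (if j = 0 then 1 else 0 :: real)" for j :: int
  have len0: "partitions_len 0 = {[]}" by (auto simp: partitions_len_def Nil_in_partitions)
  have len1: "partitions_len 1 = (\<lambda>n. [Suc n]) ` UNIV"
  proof -
    have "la \<in> (\<lambda>n. [Suc n]) ` UNIV" if la: "la \<in> partitions_len 1" for la
    proof -
      obtain n where "la = [n]" "n > 0" using la by (auto simp: partitions_len_def partitions_def length_Suc_conv)
      then show ?thesis by (auto intro: image_eqI[of _ _ "n - 1"])
    qed
    then show ?thesis by (auto simp: partitions_len_def partitions_def)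
  qed
  have up: "(up_weight t a b [] [] has_sum A k) (partitions_len k)" for k
  proof -
    consider "k = 0" | "k = 1" | "k \<noteq> 0" "k \<noteq> 1" by blast
    then show ?thesis
    proof cases
      case 1
      have "up_weight t a b [] [] [] = 1" by (simp add: up_weight_def HL_P_Nil_Nil HL_Q_Nil_Nil)
      then show ?thesis using 1 len0 by (simp add: A_def has_sum_finite_iff)
    next
      case 2
      have "((\<lambda>n. (a * b) ^ n) has_sum (1 / (1 - a * b))) UNIV"
        using geometric_sums[of "a * b"] w by (intro norm_summable_imp_has_sum) (auto simp: abs_mult)
      then have "((\<lambda>n. ((1 - t) * (a * b)) * (a * b) ^ n) has_sum ((1 - t) * (a * b)) * (1 / (1 - a * b))) UNIV"
        by (rule has_sum_cmult_right)
      moreover have "up_weight t a b [] [] [Suc n] = ((1 - t) * (a * b)) * (a * b) ^ n" for n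
        unfolding up_weight_def HL_P_single_Nil HL_Q_single_Nil[OF zero_less_Suc]
        by (simp add: power_mult_distrib)
      ultimately have "(up_weight t a b [] [] has_sum A 1) (partitions_len 1)" unfolding len1
        by (subst has_sum_reindex) (auto simp: inj_def A_def o_def)
      then show ?thesis using 2 by simp
    next
      case 3
      then have "HL_P t la [] a = 0" if "la \<in> partitions_len k" for la
        using that by (intro HL_P_eq_0) (auto simp: partitions_len_def Nil_in_partitions le_Suc_eq)
      then have "up_weight t a b [] [] la = 0" if "la \<in> partitions_len k" for la
        using that by (simp add: up_weight_def)
      then show ?thesis using 3 by (simp add: A_def has_sum_0)
    qed
  qed
  have down: "(down_weight t a b [] [] has_sum B j) (partitions_len j)" for j
  proof (cases "j = 0")
    case True
    have "down_weight t a b [] [] [] = 1" by (simp add: down_weight_def HL_P_Nil_Nil HL_Q_Nil_Nil)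
    then show ?thesis using True len0 by (simp add: B_def has_sum_finite_iff)
  next
    case False
    then have "HL_P t [] la a = 0" if "la \<in> partitions_len j" for la
      using that by (intro HL_P_eq_0) (auto simp: partitions_len_def Nil_in_partitions)
    then have "down_weight t a b [] [] la = 0" if "la \<in> partitions_len j" for la
      using that by (simp add: down_weight_def)
    then show ?thesis using False by (simp add: B_def has_sum_0)
  qed
  have "exchange_rel t (a * b) 0 0 A B"
    using w by (auto simp: exchange_rel_def A_def B_def)
  with up down show ?thesis by blast
qed

text \<open>The total size drops strictly under stripping, since at least one of the two first
  columns is nonempty. Existence of the sums is part of the induction because they are obtained by
  transfer from the stripped pair.\<close>

lemma HL_exchange:
  fixes a b t :: real
  assumes w: "0 \<le> a * b" "a * b < 1"
  assumes "mu \<in> partitions" "nu \<in> partitions"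
  shows "\<exists>A B. (\<forall>k. (up_weight t a b mu nu has_sum A k) (partitions_len k)) \<and>
     (\<forall>j. (down_weight t a b mu nu has_sum B j) (partitions_len j)) \<and>
     exchange_rel t (a * b) (int (length mu)) (int (length nu)) A B"
  using assms(3,4)
proof (induction "sum_list mu + sum_list nu" arbitrary: mu nu rule: less_induct)
  case less
  show ?case
  proof (cases "mu = [] \<and> nu = []")
    case True
    then show ?thesis using exchange_rel_Nil[OF w] by simp
  next
    case False
    define mu' nu' where "mu' = strip_column mu" and "nu' = strip_column nu"
    define p q p' q' where "p = length mu" "q = length nu" "p' = length mu'" "q' = length nu'"
    have part: "mu' \<in> partitions" "nu' \<in> partitions"
      using less.prems by (auto simp: mu'_def nu'_def strip_column_in_partitions)
    have eq: "add_column p mu' = mu" "add_column q nu' = nu"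
      using less.prems by (auto simp: mu'_def nu'_def p_q_p'_q'_def add_strip_column)
    have le: "p' \<le> p" "q' \<le> q"
      by (auto simp: mu'_def nu'_def p_q_p'_q'_def length_strip_column)
    have "sum_list mu' + sum_list nu' < sum_list mu + sum_list nu"
      using False less.prems sum_list_strip_column_less[of mu] sum_list_strip_column_less[of nu]
        sum_list_strip_column_le[of mu] sum_list_strip_column_le[of nu]
      unfolding mu'_def nu'_def by linarith
    from less.hyps[OF this part] obtain A' B' where
      A': "\<And>k. (up_weight t a b mu' nu' has_sum A' k) (partitions_len k)" and
      B': "\<And>k. (down_weight t a b mu' nu' has_sum B' k) (partitions_len k)" and
      rel: "exchange_rel t (a * b) (int p') (int q') A' B'"
      unfolding p_q_p'_q'_def by blast
    note up = up_sum_add_column[OF part p_q_p'_q'_def(3,4)[symmetric] le _ _ _ _ A', unfolded eq]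
    note down = down_sum_add_column[OF part p_q_p'_q'_def(3,4)[symmetric] le _ _ _ _ B', unfolded eq]
    have up0: "(up_weight t a b mu nu has_sum 0) (partitions_len k)"
      if "\<not> (int p \<le> k \<and> k \<le> int p + 1 \<and> int q \<le> k \<and> k \<le> int q + 1)" for k
    proof (rule has_sum_0)
      fix la assume "la \<in> partitions_len k"
      then show "up_weight t a b mu nu la = 0"
        using that less.prems HL_P_eq_0[of mu la] HL_Q_eq_0[of nu la]
        by (auto simp: up_weight_def partitions_len_def p_q_p'_q'_def)
    qed
    have down0: "(down_weight t a b mu nu has_sum 0) (partitions_len j)"
      if "\<not> (0 \<le> j \<and> j \<le> int p \<and> int p \<le> j + 1 \<and> j \<le> int q \<and> int q \<le> j + 1)" for j
    proof (rule has_sum_0)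
      fix la assume "la \<in> partitions_len j"
      then show "down_weight t a b mu nu la = 0"
        using that less.prems HL_Q_eq_0[of la mu] HL_P_eq_0[of la nu]
        by (auto simp: down_weight_def partitions_len_def p_q_p'_q'_def)
    qed
    \<comment> \<open>\<open>infsum\<close> defaults to 0 for non-summable families, so summability
      is checked for each \<open>k\<close> before these values are used as sums.\<close>
    define A where "A k = infsum (up_weight t a b mu nu) (partitions_len k)" for k
    define B where "B j = infsum (down_weight t a b mu nu) (partitions_len j)" for j
    have "up_weight t a b mu nu summable_on partitions_len k" for k
    proof (cases "int p \<le> k \<and> k \<le> int p + 1 \<and> int q \<le> k \<and> k \<le> int q + 1")
      case True
      then show ?thesis using up[of "nat k"] by (auto simp: summable_on_def nat_le_iff le_nat_iff)
    qed (use up0 in \<open>auto simp: summable_on_def\<close>)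
    then have A: "(up_weight t a b mu nu has_sum A k) (partitions_len k)" for k
      by (simp add: A_def)
    have "down_weight t a b mu nu summable_on partitions_len j" for j
    proof (cases "0 \<le> j \<and> j \<le> int p \<and> int p \<le> j + 1 \<and> j \<le> int q \<and> int q \<le> j + 1")
      case True
      then have "nat j \<le> p" "p \<le> Suc (nat j)" "nat j \<le> q" "q \<le> Suc (nat j)" by auto
      from down[OF this] True show ?thesis by (auto simp: summable_on_def)
    qed (use down0 in \<open>auto simp: summable_on_def\<close>)
    then have B: "(down_weight t a b mu nu has_sum B j) (partitions_len j)" for j
      by (simp add: B_def)
    have "exchange_rel t (a * b) (int p) (int q) A B"
      by (rule exchange_rel_add_column[OF rel le])
        (unfold A_def B_def, rule infsumI, rule up, assumption+, rule infsumI, erule up0,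
          rule infsumI, rule down, assumption+, rule infsumI, erule down0)
    with A B show ?thesis unfolding p_q_p'_q'_def by blast
  qed
qed

text \<open>\<open>j\<close>, \<open>p\<close>, \<open>q\<close>, \<open>k\<close> are the lengths at the lower left, upper left, lower right and upper right
  corners of the cell around a vertex. A length grows to the right when an arrow crosses
  vertically, and upwards when the horizontal edge is empty, so the incoming edges are read off
  from \<open>j\<close>, \<open>p\<close>, \<open>q\<close>.\<close>

definition vertex_kernel :: "real \<Rightarrow> real \<Rightarrow> nat \<Rightarrow> nat \<Rightarrow> nat \<Rightarrow> nat \<Rightarrow> real" where
  "vertex_kernel Q z j p q k =
    measure_pmf.prob (vertex_pmf Q z (p = j, q = Suc j)) {out. k = p + of_bool (snd out)}"

section \<open>The vertex law in the variables t and w\<close>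

lemma vertex_kernel_nonneg: "vertex_kernel Q z j p q k \<ge> 0"
  by (simp add: vertex_kernel_def)

text \<open>The choice of \<open>z\<close> turns \<open>sqrt t * z\<close> into 1/w and
  \<open>z / sqrt t\<close> into 1/(tw). The six vertex weights then have the common denominator
  1-tw and the numerators appearing in \<open>exchange_rel\<close>.\<close>

lemma vertex_pmf_prob_top:
  assumes "0 < t" "t < 1" "0 < w" "w < 1" and z: "z = 1 / (sqrt t * w)"
  shows "measure_pmf.prob (vertex_pmf t z (True, False)) {out. snd out} = (1 - t) * w / (1 - t * w)"
    and "measure_pmf.prob (vertex_pmf t z (True, False)) {out. \<not> snd out} = (1 - w) / (1 - t * w)"
    and "measure_pmf.prob (vertex_pmf t z (False, True)) {out. snd out} = t * (1 - w) / (1 - t * w)"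
    and "measure_pmf.prob (vertex_pmf t z (False, True)) {out. \<not> snd out} = (1 - t) / (1 - t * w)"
proof -
  have sq: "sqrt t * sqrt t = t" "sqrt t > 0" using assms by auto
  have zs: "z / sqrt t = 1 / (t * w)" "sqrt t * z = 1 / w"
    using sq assms by (simp_all add: z field_simps)
  have tw: "0 < t * w" "t * w < 1" using assms mult_strict_mono[of t 1 w 1] by auto
  have p1: "(1 / t - z / sqrt t) / (1 - z / sqrt t) = (1 - w) / (1 - t * w)"
    unfolding zs using assms tw by (simp add: divide_simps) (simp add: algebra_simps)
  have p2: "(1 - sqrt t * z) / (1 - z / sqrt t) = t * (1 - w) / (1 - t * w)"
    unfolding zs using assms tw by (simp add: divide_simps) (simp add: algebra_simps)
  \<comment> \<open>\<open>bernoulli_pmf\<close> clips its parameter, so both parameters have to be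
    shown to lie in the unit interval.\<close>
  have "w * t \<le> w" using assms by (simp add: mult_left_le)
  then have r1: "(1 - w) / (1 - t * w) \<in> {0..1}" using assms tw by (auto simp: divide_simps mult.commute)
  have "t + w * t \<le> 1 + w * t" using assms by simp
  then have r2: "t * (1 - w) / (1 - t * w) \<in> {0..1}" using assms tw by (auto simp: divide_simps algebra_simps)
  have c1: "1 - (1 - w) / (1 - t * w) = (1 - t) * w / (1 - t * w)"
    and c2: "1 - t * (1 - w) / (1 - t * w) = (1 - t) / (1 - t * w)"
    using tw by (auto simp: field_simps)
  have v: "(\<lambda>r. (r, \<not> r)) -` {out. snd out} = {False}" "(\<lambda>r. (r, \<not> r)) -` {out. \<not> snd out} = {True}"
    "(\<lambda>u. (\<not> u, u)) -` {out. snd out} = {True}" "(\<lambda>u. (\<not> u, u)) -` {out. \<not> snd out} = {False}"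
    by auto
  show "measure_pmf.prob (vertex_pmf t z (True, False)) {out. snd out} = (1 - t) * w / (1 - t * w)"
    and "measure_pmf.prob (vertex_pmf t z (True, False)) {out. \<not> snd out} = (1 - w) / (1 - t * w)"
    unfolding vertex_pmf.simps p1 measure_map_pmf v using r1 c1 by (simp_all add: measure_pmf_single)
  show "measure_pmf.prob (vertex_pmf t z (False, True)) {out. snd out} = t * (1 - w) / (1 - t * w)"
    and "measure_pmf.prob (vertex_pmf t z (False, True)) {out. \<not> snd out} = (1 - t) / (1 - t * w)"
    unfolding vertex_pmf.simps p2 measure_map_pmf v using r2 c2 by (simp_all add: measure_pmf_single)
qed

text \<open>At most two lengths \<open>j\<close> survive. For p = q these are j = p, an arrow
  entering from the left, and j = p-1, an arrow entering from below. For q = p+1 both incoming edges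
  are occupied and for p = q+1 both are empty, so \<open>k\<close> is forced.\<close>

lemma exchange_rel_vertex_kernel:
  assumes rel: "exchange_rel t w (int p) (int q) A B"
    and tw: "0 < t" "t < 1" "0 < w" "w < 1" and z: "z = 1 / (sqrt t * w)"
  shows "A (int k) = (1 - t * w) / (1 - w) * (\<Sum>j\<le>p. vertex_kernel t z j p q k * B (int j))"
proof -
  note prob = vertex_pmf_prob_top[OF tw z]
  have tw1: "t * w < 1" using tw mult_strict_mono[of t 1 w 1] by auto
  have A0: "A k = 0" if "\<not> (int p \<le> k \<and> k \<le> int p + 1 \<and> int q \<le> k \<and> k \<le> int q + 1)" for k
    using rel that unfolding exchange_rel_def by blast
  have B0: "B j = 0"
    if "\<not> (0 \<le> j \<and> j \<le> int p \<and> int p \<le> j + 1 \<and> j \<le> int q \<and> int q \<le> j + 1)" for j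
    using rel that unfolding exchange_rel_def by blast
  have set: "{out. k = p + of_bool (snd out)} =
      (if k = p then {out. \<not> snd out} else if k = Suc p then {out. snd out} else {})" for k
    by auto
  have "(1 - w) * A (int k) = (1 - t * w) * (\<Sum>j\<le>p. vertex_kernel t z j p q k * B (int j))"
  proof -
    consider "q = p" | "q = Suc p" | "p = Suc q" | "q > Suc p \<or> p > Suc q" by linarith
    then show ?thesis
    proof cases
      case 1
      have R: "(1 - w) * A (int p) = (1 - w) * B (int p) + (1 - t) * B (int p - 1)"
        "(1 - w) * A (int p + 1) = (1 - t) * w * B (int p) + t * (1 - w) * B (int p - 1)"
        using rel 1 unfolding exchange_rel_def by auto
      have Kp: "vertex_kernel t z p p q k * (1 - t * w) =
          (if k = p then 1 - w else if k = Suc p then (1 - t) * w else 0)"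
        using tw1 unfolding vertex_kernel_def set by (simp add: 1 prob del: vertex_pmf.simps)
      have Kr: "vertex_kernel t z r p q k * (1 - t * w) =
          (if k = p then 1 - t else if k = Suc p then t * (1 - w) else 0)" if "p = Suc r" for r
        using tw1 that unfolding vertex_kernel_def set by (simp add: 1 prob del: vertex_pmf.simps)
      have "(1 - t * w) * (\<Sum>j\<le>p. vertex_kernel t z j p q k * B (int j)) =
         (if k = p then 1 - w else if k = Suc p then (1 - t) * w else 0) * B (int p) +
         (if k = p then 1 - t else if k = Suc p then t * (1 - w) else 0) * B (int p - 1)"
      proof (cases p)
        case 0
        then have "(1 - t * w) * (\<Sum>j\<le>p. vertex_kernel t z j p q k * B (int j)) =
          (vertex_kernel t z p p q k * (1 - t * w)) * B (int p)" by simp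
        moreover have "B (int p - 1) = 0" using 0 by (intro B0) auto
        ultimately show ?thesis unfolding Kp by simp
      next
        case (Suc r)
        have "(\<Sum>j\<le>p. vertex_kernel t z j p q k * B (int j)) = (\<Sum>j\<in>{p, r}. vertex_kernel t z j p q k * B (int j))"
          using Suc by (intro sum.mono_neutral_right) (auto intro!: B0)
        also have "\<dots> = vertex_kernel t z p p q k * B (int p) + vertex_kernel t z r p q k * B (int p - 1)"
          using Suc by simp
        finally have "(1 - t * w) * (\<Sum>j\<le>p. vertex_kernel t z j p q k * B (int j)) =
          (vertex_kernel t z p p q k * (1 - t * w)) * B (int p) +
          (vertex_kernel t z r p q k * (1 - t * w)) * B (int p - 1)" by (simp add: algebra_simps)
        then show ?thesis unfolding Kp Kr[OF Suc] .
      qed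
      then show ?thesis using R A0[of "int k"] 1 by (auto simp: add_ac)
    next
      case 2
      have R: "(1 - w) * A (int q) = (1 - t * w) * B (int p)"
        using rel 2 unfolding exchange_rel_def by auto
      have "(\<Sum>j\<le>p. vertex_kernel t z j p q k * B (int j)) = (\<Sum>j\<in>{p}. vertex_kernel t z j p q k * B (int j))"
        using 2 by (intro sum.mono_neutral_right) (auto intro!: B0)
      moreover have "vertex_kernel t z p p q k = of_bool (k = Suc p)"
        unfolding vertex_kernel_def by (simp add: 2 indicator_def)
      ultimately show ?thesis using R A0[of "int k"] 2 by (auto simp: add_ac)
    next
      case 3
      have R: "(1 - w) * A (int p) = (1 - t * w) * B (int q)"
        using rel 3 unfolding exchange_rel_def by auto
      have "(\<Sum>j\<le>p. vertex_kernel t z j p q k * B (int j)) = (\<Sum>j\<in>{q}. vertex_kernel t z j p q k * B (int j))"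
        using 3 by (intro sum.mono_neutral_right) (auto intro!: B0)
      moreover have "vertex_kernel t z q p q k = of_bool (k = p)"
        unfolding vertex_kernel_def by (simp add: 3 indicator_def)
      ultimately show ?thesis using R A0[of "int k"] 3 by (auto simp: add_ac)
    next
      case 4
      then have "(\<Sum>j\<le>p. vertex_kernel t z j p q k * B (int j)) = 0"
        by (intro sum.neutral) (auto intro!: B0)
      moreover have "A (int k) = 0" using 4 by (intro A0) auto
      ultimately show ?thesis by simp
    qed
  qed
  then show ?thesis using tw by (simp add: field_simps)
qed

section \<open>From sums of reals to integrals in the extended nonnegative reals\<close>

lemma nn_integral_count_space_has_sum:
  fixes f :: "'a \<Rightarrow> real"
  assumes "(f has_sum s) A" and "\<And>x. x \<in> A \<Longrightarrow> f x \<ge> 0"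
  shows "(\<integral>\<^sup>+x. ennreal (f x) \<partial>count_space A) = ennreal s"
proof -
  have "f summable_on A" using assms(1) by (auto simp: summable_on_def)
  then have "(\<lambda>x. norm (f x)) summable_on A"
    using assms(2) by (subst summable_on_cong[where g = f]) auto
  then have *: "Infinite_Set_Sum.abs_summable_on f A" using abs_summable_equivalent by blast
  have "(\<integral>\<^sup>+x. ennreal (f x) \<partial>count_space A) = ennreal (infsetsum f A)"
    using * assms(2) by (rule nn_integral_conv_infsetsum)
  also have "infsetsum f A = s"
    using infsetsum_infsum[OF *] infsumI[OF assms(1)] by simp
  finally show ?thesis .
qed

lemma HL_exchange_nn_integral:
  assumes "0 < t" "t < 1" "0 < a" "0 < b" "a * b < 1" and z: "z = 1 / (sqrt t * (a * b))"
    and part: "mu \<in> partitions" "nu \<in> partitions"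
  shows "(\<integral>\<^sup>+la. ennreal (up_weight t a b mu nu la) \<partial>count_space {la \<in> partitions. length la = k}) =
    ennreal ((1 - t * (a * b)) / (1 - a * b)) * (\<Sum>j\<le>length mu.
      ennreal (vertex_kernel t z j (length mu) (length nu) k) *
      (\<integral>\<^sup>+ka. ennreal (down_weight t a b mu nu ka) \<partial>count_space {ka \<in> partitions. length ka = j}))"
proof -
  have ab: "0 < a * b" using assms by simp
  obtain A B where A: "\<And>k. (up_weight t a b mu nu has_sum A k) (partitions_len k)"
    and B: "\<And>j. (down_weight t a b mu nu has_sum B j) (partitions_len j)"
    and rel: "exchange_rel t (a * b) (int (length mu)) (int (length nu)) A B"
    using HL_exchange[OF _ assms(5) part, of t] ab by auto
  have pl: "partitions_len (int k) = {la \<in> partitions. length la = k}" for k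
    by (auto simp: partitions_len_def)
  have up: "up_weight t a b mu nu la \<ge> 0" and down: "down_weight t a b mu nu la \<ge> 0" for la
    using assms by (simp_all add: up_weight_def down_weight_def HL_P_nonneg HL_Q_nonneg)
  have iA: "(\<integral>\<^sup>+la. ennreal (up_weight t a b mu nu la) \<partial>count_space {la \<in> partitions. length la = k}) = ennreal (A (int k))" for k
    using A[of "int k"] up unfolding pl by (rule nn_integral_count_space_has_sum)
  have iB: "(\<integral>\<^sup>+la. ennreal (down_weight t a b mu nu la) \<partial>count_space {la \<in> partitions. length la = k}) = ennreal (B (int k))" for k
    using B[of "int k"] down unfolding pl by (rule nn_integral_count_space_has_sum)
  have Bn: "B j \<ge> 0" for j using B[of j] down by (rule has_sum_nonneg)
  have "t * (a * b) < 1" using assms ab mult_strict_mono[of t 1 "a * b" 1] by auto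
  then have c: "(1 - t * (a * b)) / (1 - a * b) \<ge> 0" using assms by simp
  have "(\<Sum>j\<le>length mu. ennreal (vertex_kernel t z j (length mu) (length nu) k) * ennreal (B (int j))) =
      (\<Sum>j\<le>length mu. ennreal (vertex_kernel t z j (length mu) (length nu) k * B (int j)))"
    by (intro sum.cong refl ennreal_mult[symmetric] vertex_kernel_nonneg Bn)
  also have "\<dots> = ennreal (\<Sum>j\<le>length mu. vertex_kernel t z j (length mu) (length nu) k * B (int j))"
    by (intro sum_ennreal mult_nonneg_nonneg vertex_kernel_nonneg Bn)
  finally show ?thesis
    unfolding iA iB exchange_rel_vertex_kernel[OF rel assms(1,2) ab assms(5) z]
    by (simp only: ennreal_mult'[OF c])
qed

section \<open>Exchanging two signs in the Hall--Littlewood process\<close>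

lemma nn_integral_count_space_Times:
  "(\<integral>\<^sup>+x. \<integral>\<^sup>+y. f x y \<partial>count_space B \<partial>count_space A) = (\<integral>\<^sup>+p. f (fst p) (snd p) \<partial>count_space (A \<times> B))"
proof -
  have "(\<integral>\<^sup>+p. f (fst p) (snd p) \<partial>count_space (A \<times> B)) =
      (\<integral>\<^sup>+p. f (fst p) (snd p) * indicator (A \<times> B) p \<partial>count_space UNIV)"
    by (simp add: nn_integral_count_space_indicator)
  also have "\<dots> = (\<integral>\<^sup>+x. \<integral>\<^sup>+y. f x y * indicator (A \<times> B) (x, y) \<partial>count_space UNIV \<partial>count_space UNIV)"
    by (subst nn_integral_fst_count_space[symmetric]) simp
  also have "\<dots> = (\<integral>\<^sup>+x. (\<integral>\<^sup>+y. f x y * indicator B y \<partial>count_space UNIV) * indicator A x \<partial>count_space UNIV)"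
    by (intro nn_integral_cong) (auto simp: indicator_def)
  also have "\<dots> = (\<integral>\<^sup>+x. \<integral>\<^sup>+y. f x y \<partial>count_space B \<partial>count_space A)"
    by (simp add: nn_integral_count_space_indicator)
  finally show ?thesis ..
qed

definition HL_weight :: "real \<Rightarrow> (nat \<Rightarrow> real) \<Rightarrow> (nat \<Rightarrow> real) \<Rightarrow> nat \<Rightarrow> sign list \<Rightarrow> (nat \<Rightarrow> nat list) \<Rightarrow> real" where
  "HL_weight t a b N S \<Lambda> = (\<Prod>i\<in>{1..length S}. HL_factor t a b N S \<Lambda> i)"

text \<open>The lengths are prescribed at every natural index, including those where the partitions
  are empty by convention; the set is empty unless \<open>v\<close> vanishes at 0 and from
  \<open>L\<close> on.\<close>

definition length_cylinder :: "nat \<Rightarrow> (nat \<Rightarrow> nat) \<Rightarrow> (nat \<Rightarrow> nat list) set" where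
  "length_cylinder L v = {\<Lambda> \<in> partition_seqs L. \<forall>i. length (\<Lambda> i) = v i}"

definition HL_mass :: "real \<Rightarrow> (nat \<Rightarrow> real) \<Rightarrow> (nat \<Rightarrow> real) \<Rightarrow> nat \<Rightarrow> sign list \<Rightarrow> (nat \<Rightarrow> nat) \<Rightarrow> ennreal" where
  "HL_mass t a b N S v = (\<integral>\<^sup>+\<Lambda>. ennreal (HL_weight t a b N S \<Lambda>) \<partial>count_space (length_cylinder (length S) v))"

lemma pluses_pos: "1 \<le> i \<Longrightarrow> i \<le> length S \<Longrightarrow> S ! (i - 1) = Plus \<Longrightarrow> pluses S i \<ge> 1"
proof -
  assume *: "1 \<le> i" "i \<le> length S" "S ! (i - 1) = Plus"
  then have "Plus \<in> set (take i S)"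
    by (auto simp: in_set_conv_nth intro!: exI[of _ "i - 1"])
  then show ?thesis by (simp add: pluses_def Suc_le_eq count_list_0_iff flip: neq0_conv)
qed

lemma HL_factor_nonneg:
  assumes "0 < t" "t < 1" "\<And>i. i \<ge> 1 \<Longrightarrow> a i > 0" "\<And>j. j \<ge> 1 \<Longrightarrow> b j > 0" "1 \<le> i" "i \<le> length S"
  shows "HL_factor t a b N S \<Lambda> i \<ge> 0"
  using assms(1,2) assms(3)[OF pluses_pos[OF assms(5,6)]] assms(4)[of "N - minuses S i + 1"]
  by (auto simp: HL_factor_def intro!: HL_P_nonneg HL_Q_nonneg intro: less_imp_le split: sign.split)

text \<open>Prescribing length 0 at \<open>c\<close> forces the empty partition there, so the
  cylinder of \<open>v(c := 0)\<close> represents the sequences with the coordinate \<open>c\<close>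
  forgotten.\<close>

lemma bij_betw_fun_upd_length_cylinder:
  assumes c: "0 < c" "c < L"
  shows "bij_betw (\<lambda>p. (fst p)(c := snd p))
    (length_cylinder L (v(c := 0)) \<times> {la \<in> partitions. length la = v c}) (length_cylinder L v)"
  by (rule bij_betw_byWitness[where f' = "\<lambda>\<Lambda>. (\<Lambda>(c := []), \<Lambda> c)"])
     (use c in \<open>auto simp: length_cylinder_def partition_seqs_def Nil_in_partitions split: if_splits\<close>)

lemma nn_integral_length_cylinder:
  assumes c: "0 < c" "c < L"
  shows "(\<integral>\<^sup>+\<Lambda>. f \<Lambda> \<partial>count_space (length_cylinder L v)) =
    (\<integral>\<^sup>+\<Lambda>. \<integral>\<^sup>+la. f (\<Lambda>(c := la)) \<partial>count_space {la \<in> partitions. length la = v c}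
       \<partial>count_space (length_cylinder L (v(c := 0))))"
  by (subst nn_integral_count_space_Times)
     (simp add: nn_integral_bij_count_space[OF bij_betw_fun_upd_length_cylinder[OF c], symmetric])

text \<open>The prefixes of the two strings contain the same signs unless the cut falls between the
  exchanged ones, which happens only for prefix length \<open>Suc (length U)\<close>.\<close>

lemma swap_signs_unchanged:
  fixes U V :: "sign list"
  assumes i: "i \<noteq> Suc (length U)"
  shows "pluses (U @ [Plus, Minus] @ V) i = pluses (U @ [Minus, Plus] @ V) i"
    and "minuses (U @ [Plus, Minus] @ V) i = minuses (U @ [Minus, Plus] @ V) i"
    and "1 \<le> i \<Longrightarrow> i \<noteq> Suc (Suc (length U)) \<Longrightarrow> (U @ [Plus, Minus] @ V) ! (i - 1) = (U @ [Minus, Plus] @ V) ! (i - 1)"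
proof -
  have "pluses (U @ [Plus, Minus] @ V) i = pluses (U @ [Minus, Plus] @ V) i \<and>
    minuses (U @ [Plus, Minus] @ V) i = minuses (U @ [Minus, Plus] @ V) i"
  proof (cases "i \<le> length U")
    case True
    then show ?thesis by (simp add: pluses_def minuses_def)
  next
    case False
    then have "i = Suc (Suc (length U + (i - length U - 2)))" using i by auto
    then obtain d where "i = Suc (Suc (length U + d))" by blast
    then show ?thesis by (simp add: pluses_def minuses_def)
  qed
  then show "pluses (U @ [Plus, Minus] @ V) i = pluses (U @ [Minus, Plus] @ V) i"
    and "minuses (U @ [Plus, Minus] @ V) i = minuses (U @ [Minus, Plus] @ V) i" by auto
  assume "1 \<le> i" "i \<noteq> Suc (Suc (length U))"
  then show "(U @ [Plus, Minus] @ V) ! (i - 1) = (U @ [Minus, Plus] @ V) ! (i - 1)"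
    using i by (auto simp: nth_append nth_Cons split: nat.split)
qed

text \<open>Only the partition at \<open>c\<close> meets the two exchanged factors. Everything else
  is the common factor \<open>R\<close>, which can be kept fixed while the refined Cauchy identity
  is applied to the sum over that partition.\<close>

lemma HL_mass_swap:
  fixes U V :: "sign list" and N :: nat
  defines "S0 \<equiv> U @ [Minus, Plus] @ V" and "S1 \<equiv> U @ [Plus, Minus] @ V"
    and "c \<equiv> Suc (length U)" and "x \<equiv> Suc (count_list U Plus)" and "y \<equiv> N - count_list U Minus"
  assumes t: "0 < t" "t < 1" and a: "\<And>i. i \<ge> 1 \<Longrightarrow> a i > 0" and b: "\<And>j. j \<ge> 1 \<Longrightarrow> b j > 0"
    and ab: "\<And>i j. i \<ge> 1 \<Longrightarrow> j \<ge> 1 \<Longrightarrow> a i * b j < 1"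
    and N: "count_list U Minus < N" and z: "z = 1 / (sqrt t * (a x * b y))"
  shows "HL_mass t a b N S1 v =
    ennreal ((1 - t * (a x * b y)) / (1 - a x * b y)) *
    (\<Sum>j\<le>v (c - 1). ennreal (vertex_kernel t z j (v (c - 1)) (v (c + 1)) (v c)) *
        HL_mass t a b N S0 (v(c := j)))"
proof -
  define L where "L = length U + length V + 2"
  have L: "length S0 = L" "length S1 = L" by (auto simp: S0_def S1_def L_def)
  have c: "0 < c" "c < L" "Suc c \<le> L" by (auto simp: c_def L_def)
  define R where "R \<Lambda> = (\<Prod>i\<in>{1..L} - {c, Suc c}. HL_factor t a b N S0 \<Lambda> i)" for \<Lambda>
  have same: "HL_factor t a b N S1 \<Lambda> i = HL_factor t a b N S0 \<Lambda> i" if "i \<in> {1..L} - {c, Suc c}" for i \<Lambda>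
  proof -
    have i: "i \<noteq> Suc (length U)" "1 \<le> i" "i \<noteq> Suc (Suc (length U))" using that by (auto simp: c_def)
    show ?thesis unfolding HL_factor_def S0_def S1_def swap_signs_unchanged[OF i(1)]
      swap_signs_unchanged(3)[OF i] ..
  qed
  have upd: "HL_factor t a b N S (\<Lambda>(c := la)) i = HL_factor t a b N S \<Lambda> i"
    if "i \<in> {1..L} - {c, Suc c}" for S i \<Lambda> la
    using that by (auto simp: HL_factor_def split: sign.split)
  have split: "{1..L} = insert c (insert (Suc c) ({1..L} - {c, Suc c}))" using c by auto
  have w0: "HL_weight t a b N S0 (\<Lambda>(c := la)) =
      down_weight t (a x) (b y) (\<Lambda> (c - 1)) (\<Lambda> (c + 1)) la * R \<Lambda>" for \<Lambda> la
  proof -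
    have "HL_weight t a b N S0 (\<Lambda>(c := la)) = HL_factor t a b N S0 (\<Lambda>(c := la)) c *
      (HL_factor t a b N S0 (\<Lambda>(c := la)) (Suc c) * R \<Lambda>)"
      unfolding HL_weight_def L R_def by (subst split) (simp add: upd)
    moreover have "HL_factor t a b N S0 (\<Lambda>(c := la)) c = HL_Q t (\<Lambda> (c - 1)) la (b y)"
      \<comment> \<open>The count of minuses includes the current sign, so
        \<open>N - minuses S0 c + 1\<close> is \<open>N - count_list U Minus\<close>, that is
        \<open>y\<close>. The exchanged string reads off the same two parameters in the opposite
        order.\<close>
      using N by (simp add: HL_factor_def S0_def c_def y_def minuses_def Suc_diff_Suc)
    moreover have "HL_factor t a b N S0 (\<Lambda>(c := la)) (Suc c) = HL_P t (\<Lambda> (c + 1)) la (a x)"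
      by (simp add: HL_factor_def S0_def c_def x_def pluses_def nth_append)
    ultimately show ?thesis by (simp add: down_weight_def)
  qed
  have w1: "HL_weight t a b N S1 (\<Lambda>(c := la)) =
      up_weight t (a x) (b y) (\<Lambda> (c - 1)) (\<Lambda> (c + 1)) la * R \<Lambda>" for \<Lambda> la
  proof -
    have "HL_weight t a b N S1 (\<Lambda>(c := la)) = HL_factor t a b N S1 (\<Lambda>(c := la)) c *
      (HL_factor t a b N S1 (\<Lambda>(c := la)) (Suc c) * R \<Lambda>)"
      unfolding HL_weight_def L R_def by (subst split) (simp add: upd same)
    moreover have "HL_factor t a b N S1 (\<Lambda>(c := la)) c = HL_P t la (\<Lambda> (c - 1)) (a x)"
      by (simp add: HL_factor_def S1_def c_def x_def pluses_def)
    moreover have "HL_factor t a b N S1 (\<Lambda>(c := la)) (Suc c) = HL_Q t la (\<Lambda> (c + 1)) (b y)"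
      using N by (simp add: HL_factor_def S1_def c_def y_def minuses_def nth_append Suc_diff_Suc)
    ultimately show ?thesis by (simp add: up_weight_def)
  qed
  have R: "R \<Lambda> \<ge> 0" for \<Lambda>
    unfolding R_def using HL_factor_nonneg[OF t a b] L by (intro prod_nonneg) auto
  have pos: "a x > 0" "b y > 0" "a x * b y < 1" using a b ab N by (auto simp: x_def y_def)
  have up: "up_weight t (a x) (b y) mu nu la \<ge> 0" and down: "down_weight t (a x) (b y) mu nu la \<ge> 0" for mu nu la
    using pos t by (simp_all add: up_weight_def down_weight_def HL_P_nonneg HL_Q_nonneg)
  have m0: "HL_mass t a b N S0 (v(c := j)) = (\<integral>\<^sup>+\<Lambda>. (\<integral>\<^sup>+la.
      ennreal (down_weight t (a x) (b y) (\<Lambda> (c - 1)) (\<Lambda> (c + 1)) la)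
        \<partial>count_space {la \<in> partitions. length la = j}) * ennreal (R \<Lambda>)
      \<partial>count_space (length_cylinder L (v(c := 0))))" for j
    unfolding HL_mass_def L nn_integral_length_cylinder[OF c(1,2), where v = "v(c := j)"] w0
    by (simp add: ennreal_mult down R nn_integral_multc)
  have m1: "HL_mass t a b N S1 v = (\<integral>\<^sup>+\<Lambda>. (\<integral>\<^sup>+la.
      ennreal (up_weight t (a x) (b y) (\<Lambda> (c - 1)) (\<Lambda> (c + 1)) la)
        \<partial>count_space {la \<in> partitions. length la = v c}) * ennreal (R \<Lambda>)
      \<partial>count_space (length_cylinder L (v(c := 0))))"
    unfolding HL_mass_def L nn_integral_length_cylinder[OF c(1,2), where v = v] w1
    by (simp add: ennreal_mult up R nn_integral_multc)
  let ?C = "ennreal ((1 - t * (a x * b y)) / (1 - a x * b y))"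
  let ?K = "\<lambda>j. ennreal (vertex_kernel t z j (v (c - 1)) (v (c + 1)) (v c))"
  let ?D = "\<lambda>j \<Lambda>. (\<integral>\<^sup>+la. ennreal (down_weight t (a x) (b y) (\<Lambda> (c - 1)) (\<Lambda> (c + 1)) la)
        \<partial>count_space {la \<in> partitions. length la = j})"
  have "HL_mass t a b N S1 v = (\<integral>\<^sup>+\<Lambda>. ?C * (\<Sum>j\<le>v (c - 1). ?K j * (?D j \<Lambda> * ennreal (R \<Lambda>)))
      \<partial>count_space (length_cylinder L (v(c := 0))))"
    unfolding m1
  proof (rule nn_integral_cong)
    fix \<Lambda> assume "\<Lambda> \<in> space (count_space (length_cylinder L (v(c := 0))))"
    then have \<Lambda>: "\<Lambda> (c - 1) \<in> partitions" "\<Lambda> (c + 1) \<in> partitions"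
      "length (\<Lambda> (c - 1)) = v (c - 1)" "length (\<Lambda> (c + 1)) = v (c + 1)"
      using c by (auto simp: length_cylinder_def partition_seqs_def)
    show "(\<integral>\<^sup>+la. ennreal (up_weight t (a x) (b y) (\<Lambda> (c - 1)) (\<Lambda> (c + 1)) la)
        \<partial>count_space {la \<in> partitions. length la = v c}) * ennreal (R \<Lambda>) =
      ?C * (\<Sum>j\<le>v (c - 1). ?K j * (?D j \<Lambda> * ennreal (R \<Lambda>)))"
      unfolding HL_exchange_nn_integral[OF t pos z \<Lambda>(1,2)] \<Lambda>(3,4)
      by (simp add: sum_distrib_right mult.assoc)
  qed
  also have "\<dots> = ?C * (\<Sum>j\<le>v (c - 1). ?K j * HL_mass t a b N S0 (v(c := j)))"
    unfolding m0 by (simp add: nn_integral_cmult nn_integral_sum)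
  finally show ?thesis .
qed

text \<open>The transposition of the positions \<open>c\<close> and \<open>c + 1\<close> carries
  signs and parameters of one string to those of the other and keeps the order of every plus-minus
  pair, apart from the new pair \<open>(c, Suc c)\<close>, whose factor is the quotient.\<close>

lemma HL_norm_swap:
  fixes U V :: "sign list" and N :: nat
  defines "S0 \<equiv> U @ [Minus, Plus] @ V" and "S1 \<equiv> U @ [Plus, Minus] @ V"
    and "x \<equiv> Suc (count_list U Plus)" and "y \<equiv> N - count_list U Minus"
  assumes N: "count_list U Minus < N" and len: "length S0 = M + N"
  shows "HL_norm t a b M N S1 = (1 - t * (a x * b y)) / (1 - a x * b y) * HL_norm t a b M N S0"
proof -
  define c where "c = Suc (length U)"
  define pairs where "pairs S = {(i, j). 1 \<le> i \<and> i < j \<and> j \<le> M + N \<and> S ! (i - 1) = Plus \<and> S ! (j - 1) = Minus}"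
    for S :: "sign list"
  define g where "g S = (\<lambda>(i, j). (1 - t * a (pluses S i) * b (N - minuses S j + 1)) /
        (1 - a (pluses S i) * b (N - minuses S j + 1)))" for S
  have norm: "HL_norm t a b M N S = prod (g S) (pairs S)" for S
    by (simp add: HL_norm_def g_def pairs_def)
  define \<tau> where "\<tau> i = (if i = c then Suc c else if i = Suc c then c else i)" for i
  have \<tau>\<tau>: "\<tau> (\<tau> i) = i" for i by (auto simp: \<tau>_def)
  have c: "1 \<le> c" "Suc c \<le> M + N" using len by (auto simp: c_def S0_def)
  have nth_c: "S0 ! (c - 1) = Minus" "S0 ! (Suc c - 1) = Plus" "S1 ! (c - 1) = Plus" "S1 ! (Suc c - 1) = Minus"
    by (simp_all add: S0_def S1_def c_def nth_append)
  have cnt_c: "minuses S0 c = Suc (count_list U Minus)" "minuses S1 (Suc c) = Suc (count_list U Minus)"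
    "pluses S0 (Suc c) = x" "pluses S1 c = x"
    by (simp_all add: S0_def S1_def c_def x_def minuses_def pluses_def)
  have nth: "S1 ! (\<tau> i - 1) = S0 ! (i - 1)" if "1 \<le> i" for i
  proof (cases "i = c \<or> i = Suc c")
    case True
    then show ?thesis using nth_c by (auto simp: \<tau>_def)
  next
    case False
    then have "\<tau> i = i" by (simp add: \<tau>_def)
    then show ?thesis using swap_signs_unchanged(3)[of i U V] False that by (simp add: S0_def S1_def c_def)
  qed
  have plus: "pluses S1 (\<tau> i) = pluses S0 i" if "S0 ! (i - 1) = Plus" for i
    using swap_signs_unchanged(1)[of i U V] that nth_c cnt_c
    by (cases "i = c \<or> i = Suc c") (auto simp: \<tau>_def S0_def S1_def c_def)
  have minus: "minuses S1 (\<tau> i) = minuses S0 i" if "S0 ! (i - 1) = Minus" for i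
    using swap_signs_unchanged(2)[of i U V] that nth_c cnt_c
    by (cases "i = c \<or> i = Suc c") (auto simp: \<tau>_def S0_def S1_def c_def)
  have fin: "finite (pairs S)" for S
    by (rule finite_subset[of _ "{..M + N} \<times> {..M + N}"]) (auto simp: pairs_def)
  have cc: "(c, Suc c) \<in> pairs S1" using c nth_c by (simp add: pairs_def)
  have "HL_norm t a b M N S1 = g S1 (c, Suc c) * prod (g S1) (pairs S1 - {(c, Suc c)})"
    unfolding norm using fin cc by (rule prod.remove)
  also have "prod (g S1) (pairs S1 - {(c, Suc c)}) = prod (g S0) (pairs S0)"
  proof (rule prod.reindex_bij_witness[where i = "map_prod \<tau> \<tau>" and j = "map_prod \<tau> \<tau>"])
    fix p assume p: "p \<in> pairs S1 - {(c, Suc c)}"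
    then obtain i j where ij: "p = (i, j)" "1 \<le> i" "i < j" "j \<le> M + N" "S1 ! (i - 1) = Plus" "S1 ! (j - 1) = Minus"
      "(i, j) \<noteq> (c, Suc c)" by (auto simp: pairs_def)
    have "1 \<le> \<tau> i" "1 \<le> \<tau> j" "\<tau> j \<le> M + N" using ij c by (auto simp: \<tau>_def)
    moreover have "\<tau> i < \<tau> j" using ij by (auto simp: \<tau>_def)
    moreover have "S0 ! (\<tau> i - 1) = Plus" "S0 ! (\<tau> j - 1) = Minus"
      using nth[of "\<tau> i"] nth[of "\<tau> j"] ij \<open>1 \<le> \<tau> i\<close> \<open>1 \<le> \<tau> j\<close> by (simp_all add: \<tau>\<tau>)
    ultimately show "map_prod \<tau> \<tau> p \<in> pairs S0" by (simp add: ij pairs_def)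
    show "map_prod \<tau> \<tau> (map_prod \<tau> \<tau> p) = p" by (simp add: ij \<tau>\<tau>)
    show "g S0 (map_prod \<tau> \<tau> p) = g S1 p"
      using plus[of "\<tau> i"] minus[of "\<tau> j"] \<open>S0 ! (\<tau> i - 1) = Plus\<close> \<open>S0 ! (\<tau> j - 1) = Minus\<close>
      by (simp add: ij g_def \<tau>\<tau>)
  next
    fix p assume p: "p \<in> pairs S0"
    then obtain i j where ij: "p = (i, j)" "1 \<le> i" "i < j" "j \<le> M + N" "S0 ! (i - 1) = Plus" "S0 ! (j - 1) = Minus"
      by (auto simp: pairs_def)
    have "(i, j) \<noteq> (c, Suc c)" using ij nth_c by auto
    then have "\<tau> i < \<tau> j" using ij by (auto simp: \<tau>_def)
    moreover have "1 \<le> \<tau> i" "1 \<le> \<tau> j" "\<tau> j \<le> M + N" using ij c by (auto simp: \<tau>_def)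
    moreover have "S1 ! (\<tau> i - 1) = Plus" "S1 ! (\<tau> j - 1) = Minus" using nth[of i] nth[of j] ij by simp_all
    moreover have "(\<tau> i, \<tau> j) \<noteq> (c, Suc c)" using ij by (auto simp: \<tau>_def split: if_splits)
    ultimately show "map_prod \<tau> \<tau> p \<in> pairs S1 - {(c, Suc c)}" by (simp add: ij pairs_def)
    show "map_prod \<tau> \<tau> (map_prod \<tau> \<tau> p) = p" by (simp add: ij \<tau>\<tau>)
  qed
  also have "g S1 (c, Suc c) = (1 - t * (a x * b y)) / (1 - a x * b y)"
    using N by (simp add: g_def cnt_c y_def Suc_diff_Suc mult.assoc)
  finally show ?thesis by (simp add: norm)
qed

lemma HL_norm_pos:
  assumes t: "0 < t" "t < 1" and a: "\<And>i. i \<ge> 1 \<Longrightarrow> a i > 0" and b: "\<And>j. j \<ge> 1 \<Longrightarrow> b j > 0"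
    and ab: "\<And>i j. i \<ge> 1 \<Longrightarrow> j \<ge> 1 \<Longrightarrow> a i * b j < 1" and len: "length S = M + N"
  shows "HL_norm t a b M N S > 0"
  unfolding HL_norm_def
proof (rule prod_pos, clarify)
  fix i j assume *: "1 \<le> i" "i < j" "j \<le> M + N" "S ! (i - 1) = Plus" "S ! (j - 1) = Minus"
  define w where "w = a (pluses S i) * b (N - minuses S j + 1)"
  have p: "pluses S i \<ge> 1" using * len by (intro pluses_pos) auto
  have "0 < w" "w < 1" unfolding w_def using a[OF p] b ab[OF p] by auto
  moreover have "t * w < 1" using t \<open>0 < w\<close> \<open>w < 1\<close> mult_strict_mono[of t 1 w 1] by auto
  ultimately show "0 < (1 - t * a (pluses S i) * b (N - minuses S j + 1)) /
      (1 - a (pluses S i) * b (N - minuses S j + 1))"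
    by (simp add: w_def mult.assoc)
qed

section \<open>The string with all minuses before all pluses\<close>

lemma HL_norm_replicate: "HL_norm t a b M N (replicate N Minus @ replicate M Plus) = 1"
  unfolding HL_norm_def
  by (rule prod.neutral) (auto simp: nth_append split: if_splits)

text \<open>Emptiness spreads from both ends: along the minuses each partition lies below its left
  neighbour, starting from the empty one at 0; along the pluses each lies below its right neighbour,
  ending with the empty one at \<open>M + N\<close>.\<close>

lemma HL_weight_replicate:
  assumes "\<Lambda> \<in> partition_seqs (M + N)"
  shows "HL_weight t a b N (replicate N Minus @ replicate M Plus) \<Lambda> = of_bool (\<Lambda> = (\<lambda>_. []))"
proof -
  define S where "S = replicate N Minus @ replicate M Plus"
  have nth: "S ! (i - 1) = (if i \<le> N then Minus else Plus)" if "1 \<le> i" "i \<le> M + N" for i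
    using that by (auto simp: S_def nth_append)
  have part: "\<Lambda> i \<in> partitions" for i using assms by (simp add: partition_seqs_def)
  show ?thesis
  proof (cases "\<Lambda> = (\<lambda>_. [])")
    case True
    then have "HL_factor t a b N S \<Lambda> i = 1" for i
      by (simp add: HL_factor_def HL_P_Nil_Nil HL_Q_Nil_Nil split: sign.split)
    then show ?thesis using True by (simp add: HL_weight_def flip: S_def)
  next
    case False
    have "HL_weight t a b N S \<Lambda> = 0"
    proof (rule ccontr)
      assume "HL_weight t a b N S \<Lambda> \<noteq> 0"
      then have ne: "HL_factor t a b N S \<Lambda> i \<noteq> 0" if "1 \<le> i" "i \<le> M + N" for i
        using that by (auto simp: HL_weight_def S_def prod_zero_iff)
      have lo: "\<Lambda> i = []" if "i \<le> N" for i
        using that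
      proof (induction i)
        case 0
        then show ?case using assms by (simp add: partition_seqs_def)
      next
        case (Suc i)
        then have "HL_Q t [] (\<Lambda> (Suc i)) (b (N - minuses S (Suc i) + 1)) \<noteq> 0"
          using ne[of "Suc i"] nth[of "Suc i"] by (simp add: HL_factor_def)
        then show ?case using HL_Q_eq_0[OF part Nil_in_partitions] by fastforce
      qed
      have hi: "\<Lambda> (M + N - d) = []" if "d \<le> M" for d
        using that
      proof (induction d)
        case 0
        then show ?case using assms by (simp add: partition_seqs_def)
      next
        case (Suc d)
        then have "\<not> M + N - d \<le> N" by simp
        with Suc have "HL_P t [] (\<Lambda> (M + N - Suc d)) (a (pluses S (M + N - d))) \<noteq> 0"
          using ne[of "M + N - d"] nth[of "M + N - d"] by (simp add: HL_factor_def)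
        then show ?case using HL_P_eq_0[OF part Nil_in_partitions] by fastforce
      qed
      have "\<Lambda> i = []" for i
      proof -
        consider "i \<le> N" | "N < i" "i \<le> M + N" | "i > M + N" by linarith
        then show ?thesis
        proof cases
          case 2
          then show ?thesis using hi[of "M + N - i"] by simp
        next
          case 3
          then show ?thesis using assms by (simp add: partition_seqs_def)
        qed (rule lo)
      qed
      then show False using False by auto
    qed
    then show ?thesis using False by (simp add: S_def)
  qed
qed

lemma HL_mass_replicate:
  "HL_mass t a b N (replicate N Minus @ replicate M Plus) v = of_bool (\<forall>i. v i = 0)"
proof -
  let ?S = "replicate N Minus @ replicate M Plus"
  have len: "length ?S = M + N" by simp
  have eq: "HL_mass t a b N ?S v =
      (\<integral>\<^sup>+\<Lambda>. of_bool (\<Lambda> = (\<lambda>_. [])) \<partial>count_space (length_cylinder (M + N) v))"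
    unfolding HL_mass_def len
    by (intro nn_integral_cong) (auto simp: length_cylinder_def HL_weight_replicate)
  show ?thesis
  proof (cases "\<forall>i. v i = 0")
    case True
    then have "length_cylinder (M + N) v = {\<lambda>_. []}"
      by (auto simp: length_cylinder_def partition_seqs_def Nil_in_partitions)
    then show ?thesis unfolding eq using True by (simp add: nn_integral_count_space_finite)
  next
    case False
    then have "(\<lambda>_. []) \<notin> length_cylinder (M + N) v" by (auto simp: length_cylinder_def)
    then have "(\<integral>\<^sup>+\<Lambda>. of_bool (\<Lambda> = (\<lambda>_. [])) \<partial>count_space (length_cylinder (M + N) v)) =
      (\<integral>\<^sup>+\<Lambda>. 0 \<partial>count_space (length_cylinder (M + N) v))"
      by (intro nn_integral_cong) auto
    then show ?thesis unfolding eq using False by simp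
  qed
qed

section \<open>Exchanging two signs in the six vertex model\<close>

text \<open>This is $y - h(x+1,y)$.\<close>

definition empty_count :: "((nat \<times> nat) \<times> (bool \<times> bool) \<Rightarrow> bool \<times> bool) \<Rightarrow> nat \<times> nat \<Rightarrow> nat" where
  "empty_count \<omega> = (\<lambda>(x, y). card {y' \<in> {1..y}. \<not> fst (incoming \<omega> (Suc x, y'))})"

lemma empty_count_0 [simp]: "empty_count \<omega> (0, y) = 0" "empty_count \<omega> (x, 0) = 0"
  by (auto simp: empty_count_def incoming.simps[of _ "Suc 0"])

lemma empty_count_Suc:
  "empty_count \<omega> (x, Suc y) = empty_count \<omega> (x, y) + of_bool (\<not> fst (incoming \<omega> (Suc x, Suc y)))"
proof -
  have "{y' \<in> {1..Suc y}. \<not> fst (incoming \<omega> (Suc x, y'))} =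
      {y' \<in> {1..y}. \<not> fst (incoming \<omega> (Suc x, y'))} \<union> (if fst (incoming \<omega> (Suc x, Suc y)) then {} else {Suc y})"
    by (auto simp: le_Suc_eq)
  then show ?thesis by (auto simp: empty_count_def card_insert_if)
qed

lemma height_fn_eq_empty_count:
  "int y - int (height_fn (restrict (incoming \<omega>) vertices) (x + 1) y) = int (empty_count \<omega> (x, y))"
proof -
  have "height_fn (restrict (incoming \<omega>) vertices) (x + 1) y = card {y' \<in> {1..y}. fst (incoming \<omega> (Suc x, y'))}"
    unfolding height_fn_def by (intro arg_cong[of _ _ card]) (auto simp: vertices_def)
  moreover have "card {1..y} = card {y' \<in> {1..y}. fst (incoming \<omega> (Suc x, y'))} +
      card {y' \<in> {1..y}. \<not> fst (incoming \<omega> (Suc x, y'))}"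
    by (subst card_Un_disjoint[symmetric]) (auto intro!: arg_cong[of _ _ card] simp del: card_atLeastAtMost)
  ultimately show ?thesis by (simp add: empty_count_def)
qed

text \<open>Only almost sure: the draws are arbitrary functions, which need not respect the support of
  the vertex law.\<close>

definition arrow_conserving :: "((nat \<times> nat) \<times> (bool \<times> bool) \<Rightarrow> bool \<times> bool) \<Rightarrow> bool" where
  "arrow_conserving \<omega> \<longleftrightarrow> (\<forall>v\<in>vertices. \<forall>s. (of_bool (fst (\<omega> (v, s))) + of_bool (snd (\<omega> (v, s))) :: nat) =
     of_bool (fst s) + of_bool (snd s))"

text \<open>Conservation of arrows in the bottom \<open>y\<close> vertices of one column: none enter
  from below, so the arrows that enter from the left but do not leave to the right are balanced by
  the edge leaving the top of the column.\<close>

lemma empty_count_Suc_column: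
  assumes "arrow_conserving \<omega>"
  shows "empty_count \<omega> (Suc x, y) = empty_count \<omega> (x, y) + of_bool (snd (incoming \<omega> (Suc x, Suc y)))"
proof (induction y)
  case 0
  then show ?case by (simp add: incoming.simps[of _ "Suc x" "Suc 0"])
next
  case (Suc y)
  define s where "s = incoming \<omega> (Suc x, Suc y)"
  have "fst (incoming \<omega> (Suc (Suc x), Suc y)) = fst (\<omega> ((Suc x, Suc y), s))"
    by (simp add: incoming.simps[of _ "Suc (Suc x)"] s_def)
  moreover have "snd (incoming \<omega> (Suc x, Suc (Suc y))) = snd (\<omega> ((Suc x, Suc y), s))"
    by (simp add: incoming.simps[of _ _ "Suc (Suc y)"] s_def)
  moreover have "(of_bool (fst (\<omega> ((Suc x, Suc y), s))) + of_bool (snd (\<omega> ((Suc x, Suc y), s))) :: nat) =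
     of_bool (fst s) + of_bool (snd s)"
  proof -
    have "(Suc x, Suc y) \<in> vertices" by (simp add: vertices_def)
    then show ?thesis using assms unfolding arrow_conserving_def by blast
  qed
  ultimately show ?case
    using Suc by (simp add: empty_count_Suc flip: s_def)
      (cases "fst s"; cases "snd s"; auto split: if_splits)
qed

text \<open>A draw at a vertex influences only edges leaving it and edges reached later by up-right
  moves. The incoming edges of the vertex itself are not affected.\<close>

lemma incoming_fun_upd:
  assumes "\<not> (x \<le> x' \<and> y \<le> y' \<and> (x', y') \<noteq> (x, y))"
  shows "incoming (f(((x, y), s) := z)) (x', y') = incoming f (x', y')"
  using assms
proof (induction "x' + y'" arbitrary: x' y' rule: less_induct)
  case less
  have "fst ((f(((x, y), s) := z)) ((x' - 1, y'), incoming (f(((x, y), s) := z)) (x' - 1, y'))) =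
      fst (f ((x' - 1, y'), incoming f (x' - 1, y')))" if "\<not> x' \<le> 1"
  proof -
    have "\<not> (x \<le> x' - 1 \<and> y \<le> y')" using less.prems that by auto
    then show ?thesis using less.hyps[of "x' - 1" y'] that by auto
  qed
  moreover have "snd ((f(((x, y), s) := z)) ((x', y' - 1), incoming (f(((x, y), s) := z)) (x', y' - 1))) =
      snd (f ((x', y' - 1), incoming f (x', y' - 1)))" if "\<not> y' \<le> 1"
  proof -
    have "\<not> (x \<le> x' \<and> y \<le> y' - 1)" using less.prems that by auto
    then show ?thesis using less.hyps[of x' "y' - 1"] that by auto
  qed
  ultimately show ?case
    by (subst (1 2) incoming.simps) auto
qed

text \<open>The count at \<open>(x', y')\<close> inspects left edges of column x'+1, which are
  outputs of column x'. The recursion is therefore unfolded once: the bottom edges in column x'+1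
  may well depend on the changed draw, and only the left edges are claimed to be stable.\<close>

lemma empty_count_fun_upd:
  assumes "\<not> (x \<le> x' \<and> y \<le> y')"
  shows "empty_count (f(((x, y), s) := z)) (x', y') = empty_count f (x', y')"
proof -
  have "fst (incoming (f(((x, y), s) := z)) (Suc x', k)) = fst (incoming f (Suc x', k))" if "k \<le> y'" for k
  proof (cases x')
    case 0
    then show ?thesis by (simp add: incoming.simps)
  next
    case (Suc r)
    have "\<not> (x \<le> x' \<and> y \<le> k)" using assms that by auto
    then show ?thesis
      using incoming_fun_upd[of x x' y k f s z] Suc by (auto simp: incoming.simps[of _ "Suc (Suc r)"])
  qed
  then show ?thesis unfolding empty_count_def by (auto intro!: arg_cong[of _ _ card])
qed

section \<open>Measurability, almost sure conservation and independence of a single draw\<close>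

lemma space_vertex_draws: "space (vertex_draws Q \<xi> u) = (vertices \<times> UNIV) \<rightarrow>\<^sub>E UNIV"
  by (auto simp: vertex_draws_def space_PiM case_prod_unfold PiE_def)

lemma prob_space_vertex_draws: "prob_space (vertex_draws Q \<xi> u)"
  unfolding vertex_draws_def by (rule prob_space_PiM) (auto intro: measure_pmf.prob_space_axioms)

lemma vertex_pmf_conserving:
  "out \<in> set_pmf (vertex_pmf Q z s) \<Longrightarrow>
    (of_bool (fst out) + of_bool (snd out) :: nat) = of_bool (fst s) + of_bool (snd s)"
  by (cases "(Q, z, s)" rule: vertex_pmf.cases) auto

lemma AE_arrow_conserving: "AE \<omega> in vertex_draws Q \<xi> u. arrow_conserving \<omega>"
proof -
  define M where "M = (\<lambda>((x, y), s). measure_pmf (vertex_pmf Q (\<xi> x * u y) s))"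
  have "AE \<omega> in vertex_draws Q \<xi> u. (of_bool (fst (\<omega> (v, s))) + of_bool (snd (\<omega> (v, s))) :: nat) =
     of_bool (fst s) + of_bool (snd s)" if "v \<in> vertices" for v s
  proof -
    have "AE out in M (v, s). (of_bool (fst out) + of_bool (snd out) :: nat) = of_bool (fst s) + of_bool (snd s)"
      unfolding M_def case_prod_unfold AE_measure_pmf_iff by (intro ballI) (rule vertex_pmf_conserving, simp)
    moreover have "prob_space (M i)" for i
      by (auto simp: M_def case_prod_unfold intro: measure_pmf.prob_space_axioms)
    ultimately show ?thesis
      unfolding vertex_draws_def M_def[symmetric] using that by (intro AE_PiM_component) auto
  qed
  then have "AE \<omega> in vertex_draws Q \<xi> u. \<forall>p\<in>vertices \<times> UNIV.
     (of_bool (fst (\<omega> p)) + of_bool (snd (\<omega> p)) :: nat) = of_bool (fst (snd p)) + of_bool (snd (snd p))"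
    by (subst AE_ball_countable) auto
  then show ?thesis by eventually_elim (auto simp: arrow_conserving_def)
qed

lemma measurable_empty_count [measurable]:
  "(\<lambda>\<omega>. empty_count \<omega> p) \<in> vertex_draws Q \<xi> u \<rightarrow>\<^sub>M count_space UNIV"
proof -
  have 1: "(\<lambda>\<omega>. fst (incoming \<omega> (Suc x, y'))) \<in> vertex_draws Q \<xi> u \<rightarrow>\<^sub>M count_space UNIV" if "y' \<ge> 1" for x y'
    using measurable_compose[OF measurable_incoming[of "Suc x" y'], of fst "count_space UNIV"] that by simp
  show ?thesis
    unfolding empty_count_def case_prod_unfold
  proof (rule measurable_card)
    fix k
    show "{\<omega> \<in> space (vertex_draws Q \<xi> u). k \<in> {y' \<in> {1..snd p}. \<not> fst (incoming \<omega> (Suc (fst p), y'))}}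
        \<in> sets (vertex_draws Q \<xi> u)"
      using 1[of k "fst p"] by (cases "k \<in> {1..snd p}") (auto simp: pred_def)
  qed
qed

text \<open>Splitting off the coordinate \<open>i\<close> writes the product measure as a product of
  two factors. An event that ignores \<open>i\<close> becomes a full strip over an event
  \<open>E'\<close> of the remaining coordinates, and intersecting with a condition on
  \<open>i\<close> gives a rectangle.\<close>

lemma emeasure_PiM_indep_coordinate:
  assumes M: "\<And>i. i \<in> J \<Longrightarrow> prob_space (M i)" and i: "i \<in> J"
    and E: "E \<in> sets (PiM J M)" and X: "X \<in> sets (M i)"
    and indep: "\<And>f z. f \<in> space (PiM J M) \<Longrightarrow> z \<in> space (M i) \<Longrightarrow> f(i := z) \<in> E \<longleftrightarrow> f \<in> E"
  shows "emeasure (PiM J M) (E \<inter> {f \<in> space (PiM J M). f i \<in> X}) = emeasure (PiM J M) E * emeasure (M i) X"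
proof -
  define P where "P = PiM (J - {i}) M"
  interpret Mi: prob_space "M i" using M i by simp
  interpret P: prob_space P unfolding P_def using M by (intro prob_space_PiM) auto
  have J: "insert i (J - {i}) = J" using i by auto
  have D: "PiM J M = distr (M i \<Otimes>\<^sub>M P) (PiM J M) (\<lambda>(x, f). f(i := x))"
    using distr_pair_PiM_eq_PiM[of "J - {i}" M i] M i unfolding P_def J by simp
  have upd: "(\<lambda>(x, f). f(i := x)) \<in> M i \<Otimes>\<^sub>M P \<rightarrow>\<^sub>M PiM J M"
    unfolding P_def by (subst J[symmetric]) measurable
  obtain z where z: "z \<in> space (M i)" using Mi.not_empty by auto
  \<comment> \<open>The coordinate \<open>i\<close> is filled with an arbitrary point
    \<open>z\<close>; insensitivity of \<open>E\<close> to this coordinate makes the choice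
    immaterial.\<close>
  define E' where "E' = {f \<in> space P. f(i := z) \<in> E}"
  have "(\<lambda>f. f(i := z)) \<in> P \<rightarrow>\<^sub>M PiM J M"
    using measurable_compose[OF measurable_Pair1'[OF z, of P] upd] by simp
  from measurable_sets[OF this E] have E': "E' \<in> sets P"
    by (simp add: E'_def vimage_def Int_def conj_commute)
  have F: "emeasure (PiM J M) (E \<inter> {f \<in> space (PiM J M). f i \<in> Y}) = emeasure (M i) Y * emeasure P E'"
    if Y: "Y \<in> sets (M i)" for Y
  proof -
    have S: "E \<inter> {f \<in> space (PiM J M). f i \<in> Y} \<in> sets (PiM J M)"
      using E Y i by measurable
    have "emeasure (PiM J M) (E \<inter> {f \<in> space (PiM J M). f i \<in> Y}) =
      emeasure (M i \<Otimes>\<^sub>M P) ((\<lambda>(x, f). f(i := x)) -` (E \<inter> {f \<in> space (PiM J M). f i \<in> Y}) \<inter> space (M i \<Otimes>\<^sub>M P))"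
      by (subst D) (rule emeasure_distr[OF upd S])
    also have "(\<lambda>(x, f). f(i := x)) -` (E \<inter> {f \<in> space (PiM J M). f i \<in> Y}) \<inter> space (M i \<Otimes>\<^sub>M P) = Y \<times> E'"
    proof -
      have sp: "f(i := x) \<in> space (PiM J M)" if "x \<in> space (M i)" "f \<in> space P" for x f
        using measurable_space[OF upd, of "(x, f)"] that by (simp add: space_pair_measure)
      have "f(i := x) \<in> E \<longleftrightarrow> f(i := z) \<in> E" if "x \<in> space (M i)" "f \<in> space P" for x f
        using indep[OF sp[OF z that(2)] that(1)] by simp
      then show ?thesis
        using sp sets.sets_into_space[OF Y] by (auto simp: space_pair_measure E'_def)
    qed
    also have "emeasure (M i \<Otimes>\<^sub>M P) (Y \<times> E') = emeasure (M i) Y * emeasure P E'"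
      using Y E' by (rule P.emeasure_pair_measure_Times)
    finally show ?thesis .
  qed
  have "E \<inter> {f \<in> space (PiM J M). f i \<in> space (M i)} = E"
    using sets.sets_into_space[OF E] i by (auto simp: space_PiM)
  then have "emeasure (PiM J M) E = emeasure P E'"
    using F[OF sets.top] Mi.emeasure_space_1 by simp
  then show ?thesis using F[OF X] by (simp add: mult.commute)
qed

section \<open>Masses of height vectors along a path\<close>

lemma dr_path_eq: "i \<le> length S \<Longrightarrow> dr_path N S i = (pluses S i, N - minuses S i)"
proof (induction i)
  case (Suc i)
  then show ?case
    by (cases "S ! i") (auto simp: pluses_def minuses_def take_Suc_conv_app_nth)
qed (simp add: pluses_def minuses_def)

lemma pluses_mono: "i \<le> j \<Longrightarrow> pluses S i \<le> pluses S j"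
  and minuses_mono: "i \<le> j \<Longrightarrow> minuses S i \<le> minuses S j"
  by (auto simp: pluses_def minuses_def take_add dest!: le_Suc_ex)

text \<open>A set of draws rather than of configurations, since independence of the new vertex is
  available only for the draws.\<close>

definition height_cylinder ::
  "real \<Rightarrow> (nat \<Rightarrow> real) \<Rightarrow> (nat \<Rightarrow> real) \<Rightarrow> nat \<Rightarrow> sign list \<Rightarrow> (nat \<Rightarrow> nat) \<Rightarrow>
    ((nat \<times> nat) \<times> (bool \<times> bool) \<Rightarrow> bool \<times> bool) set" where
  "height_cylinder Q \<xi> u N S v = {\<omega> \<in> space (vertex_draws Q \<xi> u).
     \<forall>i\<le>length S. empty_count \<omega> (pluses S i, N - minuses S i) = v i}"

lemma height_cylinder_sets [measurable]: "height_cylinder Q \<xi> u N S v \<in> sets (vertex_draws Q \<xi> u)"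
proof -
  have 1: "{\<omega> \<in> space (vertex_draws Q \<xi> u). empty_count \<omega> p = k} \<in> sets (vertex_draws Q \<xi> u)" for p k
    using measurable_sets[OF measurable_empty_count, of "{k}" p Q \<xi> u]
    by (simp add: vimage_def Int_def conj_commute)
  have "height_cylinder Q \<xi> u N S v = {\<omega> \<in> space (vertex_draws Q \<xi> u).
      \<forall>i\<in>{..length S}. empty_count \<omega> (pluses S i, N - minuses S i) = v i}"
    by (auto simp: height_cylinder_def)
  also have "\<dots> \<in> sets (vertex_draws Q \<xi> u)"
    by (intro sets.sets_Collect_finite_All 1) auto
  finally show ?thesis .
qed

definition height_mass ::
  "real \<Rightarrow> (nat \<Rightarrow> real) \<Rightarrow> (nat \<Rightarrow> real) \<Rightarrow> nat \<Rightarrow> sign list \<Rightarrow> (nat \<Rightarrow> nat) \<Rightarrow> ennreal" where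
  "height_mass Q \<xi> u N S v = emeasure (vertex_draws Q \<xi> u) (height_cylinder Q \<xi> u N S v)"

text \<open>Given the counts along the old path, the state of the edges entering the new vertex is
  determined, and the new count depends on its draw alone. Summing over the count \<open>j\<close>
  at the replaced corner gives the kernel.\<close>

lemma height_mass_swap:
  fixes U V :: "sign list" and N :: nat
  defines "S0 \<equiv> U @ [Minus, Plus] @ V" and "S1 \<equiv> U @ [Plus, Minus] @ V"
    and "c \<equiv> Suc (length U)" and "x \<equiv> Suc (count_list U Plus)" and "y \<equiv> N - count_list U Minus"
  assumes N: "count_list U Minus < N"
  shows "height_mass Q \<xi> u N S1 v =
    (\<Sum>j\<le>v (c - 1). ennreal (vertex_kernel Q (\<xi> x * u y) j (v (c - 1)) (v (c + 1)) (v c)) *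
        height_mass Q \<xi> u N S0 (v(c := j)))"
proof -
  define L where "L = length U + length V + 2"
  have L: "length S0 = L" "length S1 = L" by (auto simp: S0_def S1_def L_def)
  have c: "0 < c" "c < L" "Suc c \<le> L" by (auto simp: c_def L_def)
  define x0 y0 where "x0 = count_list U Plus" and "y0 = y - 1"
  have xy: "x = Suc x0" "y = Suc y0" using N by (auto simp: x_def x0_def y_def y0_def)
  define D where "D = vertex_draws Q \<xi> u"
  define pt where "pt S i = (pluses S i, N - minuses S i)" for S i
  have pt_same: "pt S1 i = pt S0 i" if "i \<noteq> c" for i
    unfolding pt_def S0_def S1_def using swap_signs_unchanged(1,2)[of i U V] that by (simp add: c_def)
  have pt1: "pt S1 c = (Suc x0, Suc y0)" and pt0: "pt S0 c = (x0, y0)"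
    and pt_before: "pt S0 (c - 1) = (x0, Suc y0)" and pt_after: "pt S0 (c + 1) = (Suc x0, y0)"
    using xy(2) N by (simp_all add: pt_def S0_def S1_def c_def x0_def y0_def y_def pluses_def minuses_def)
  \<comment> \<open>Up to step \<open>c\<close> the old path stays in columns below
    \<open>x\<close>, and from then on in rows below \<open>y\<close>. Hence no count along it uses
    a draw at the new vertex.\<close>
  have avoid: "\<not> (x \<le> fst (pt S0 i) \<and> y \<le> snd (pt S0 i))" for i
  proof (cases "i \<le> c")
    case True
    then have "fst (pt S0 i) \<le> fst (pt S0 c)" using pluses_mono[of i c S0] by (simp add: pt_def)
    then show ?thesis using xy pt0 by simp
  next
    case False
    then have "snd (pt S0 i) \<le> snd (pt S0 c)" using minuses_mono[of c i S0] by (simp add: pt_def)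
    then show ?thesis using xy pt0 by simp
  qed
  define E where "E j = height_cylinder Q \<xi> u N S0 (v(c := j))" for j
  \<comment> \<open>On \<open>E j\<close> this is the actual incoming state of the new vertex, so on
    that event the draw that matters is the one at the fixed coordinate
    \<open>((x, y), s j)\<close>.\<close>
  define s where "s j = (v (c - 1) = j, v (c + 1) = Suc j)" for j
  define X where "X = {out :: bool \<times> bool. v c = v (c - 1) + of_bool (snd out)}"
  define F where "F j = {\<omega> \<in> space D. \<omega> ((x, y), s j) \<in> X}" for j
  have E_iff: "\<omega> \<in> E j \<longleftrightarrow> \<omega> \<in> space D \<and> (\<forall>i\<le>L. i \<noteq> c \<longrightarrow> empty_count \<omega> (pt S0 i) = v i) \<and>
      empty_count \<omega> (x0, y0) = j" for \<omega> j
  proof -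
    have "(\<forall>i\<le>L. empty_count \<omega> (pt S0 i) = (v(c := j)) i) \<longleftrightarrow>
      (\<forall>i\<le>L. i \<noteq> c \<longrightarrow> empty_count \<omega> (pt S0 i) = v i) \<and> empty_count \<omega> (x0, y0) = j"
      using c pt0 by auto
    then show ?thesis unfolding E_def height_cylinder_def L D_def pt_def by blast
  qed
  have G_iff: "\<omega> \<in> height_cylinder Q \<xi> u N S1 v \<longleftrightarrow>
      \<omega> \<in> space D \<and> (\<forall>i\<le>L. i \<noteq> c \<longrightarrow> empty_count \<omega> (pt S0 i) = v i) \<and>
      empty_count \<omega> (Suc x0, Suc y0) = v c" for \<omega>
  proof -
    have "(\<forall>i\<le>L. empty_count \<omega> (pt S1 i) = v i) \<longleftrightarrow>
      (\<forall>i\<le>L. i \<noteq> c \<longrightarrow> empty_count \<omega> (pt S0 i) = v i) \<and> empty_count \<omega> (Suc x0, Suc y0) = v c"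
    proof (intro iffI conjI allI impI)
      fix i assume *: "\<forall>i\<le>L. empty_count \<omega> (pt S1 i) = v i" "i \<le> L" "i \<noteq> c"
      then show "empty_count \<omega> (pt S0 i) = v i" using pt_same[of i] by auto
    next
      assume "\<forall>i\<le>L. empty_count \<omega> (pt S1 i) = v i"
      then have "empty_count \<omega> (pt S1 c) = v c" using c by simp
      then show "empty_count \<omega> (Suc x0, Suc y0) = v c" unfolding pt1 .
    next
      fix i assume "(\<forall>i\<le>L. i \<noteq> c \<longrightarrow> empty_count \<omega> (pt S0 i) = v i) \<and> empty_count \<omega> (Suc x0, Suc y0) = v c" "i \<le> L"
      then show "empty_count \<omega> (pt S1 i) = v i" using pt1 pt_same[of i] by (cases "i = c") auto
    qed
    then show ?thesis unfolding height_cylinder_def L D_def pt_def by blast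
  qed
  have sets [measurable]: "E j \<in> sets D" "F j \<in> sets D" for j
  proof -
    show "E j \<in> sets D" by (simp add: E_def D_def)
    have "(\<lambda>\<omega>. \<omega> ((x, y), s j)) \<in> D \<rightarrow>\<^sub>M measure_pmf (vertex_pmf Q (\<xi> x * u y) (s j))"
      unfolding D_def vertex_draws_def
      using measurable_component_singleton[of "((x, y), s j)" "vertices \<times> UNIV"
          "\<lambda>((x, y), s). measure_pmf (vertex_pmf Q (\<xi> x * u y) s)"] xy
      by (simp add: vertices_def)
    from measurable_sets[OF this, of X] show "F j \<in> sets D"
      by (simp add: F_def vimage_def Int_def conj_commute)
  qed
  have indep: "emeasure D (E j \<inter> F j) =
      emeasure D (E j) * ennreal (vertex_kernel Q (\<xi> x * u y) j (v (c - 1)) (v (c + 1)) (v c))" for j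
  proof -
    define M where "M = (\<lambda>((x, y), s). measure_pmf (vertex_pmf Q (\<xi> x * u y) s))"
    have D: "D = PiM (vertices \<times> UNIV) M" by (simp add: D_def vertex_draws_def M_def)
    have "emeasure D (E j \<inter> F j) = emeasure D (E j) * emeasure (M ((x, y), s j)) X"
      unfolding D F_def
    proof (rule emeasure_PiM_indep_coordinate)
      show "prob_space (M i)" for i by (auto simp: M_def case_prod_unfold intro: measure_pmf.prob_space_axioms)
      show i: "((x, y), s j) \<in> vertices \<times> UNIV" by (simp add: vertices_def xy)
      show "E j \<in> sets (PiM (vertices \<times> UNIV) M)" using sets(1)[of j] by (simp add: D)
      show "X \<in> sets (M ((x, y), s j))" by (simp add: M_def)
      fix f and z :: "bool \<times> bool" assume f: "f \<in> space (PiM (vertices \<times> UNIV) M)"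
      have "empty_count (f(((x, y), s j) := z)) (pt S0 i) = empty_count f (pt S0 i)" for i
        using empty_count_fun_upd[of x "fst (pt S0 i)" y "snd (pt S0 i)" f "s j" z] avoid[of i] by simp
      moreover have "f(((x, y), s j) := z) \<in> space D"
        using f i unfolding D[symmetric] D_def space_vertex_draws
        by (auto simp: PiE_def extensional_def)
      ultimately show "f(((x, y), s j) := z) \<in> E j \<longleftrightarrow> f \<in> E j"
        using f unfolding E_iff D[symmetric] pt0[symmetric] by simp
    qed
    also have "emeasure (M ((x, y), s j)) X =
        ennreal (vertex_kernel Q (\<xi> x * u y) j (v (c - 1)) (v (c + 1)) (v c))"
      by (simp add: M_def vertex_kernel_def X_def s_def measure_pmf.emeasure_eq_measure)
    finally show ?thesis .
  qed
  \<comment> \<open>The two events agree only where arrows are conserved, which is what lets the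
    bottom edge be read off from the counts. The range of \<open>j\<close> is sufficient because a
    count cannot decrease upwards.\<close>
  have "AE \<omega> in D. \<omega> \<in> height_cylinder Q \<xi> u N S1 v \<longleftrightarrow> \<omega> \<in> (\<Union>j\<le>v (c - 1). E j \<inter> F j)"
    using AE_arrow_conserving[of Q \<xi> u, folded D_def] AE_space
  proof eventually_elim
    case (elim \<omega>)
    have e1: "empty_count \<omega> (x0, Suc y0) = empty_count \<omega> (x0, y0) + of_bool (\<not> fst (incoming \<omega> (Suc x0, Suc y0)))"
      by (rule empty_count_Suc)
    have e2: "empty_count \<omega> (Suc x0, y0) = empty_count \<omega> (x0, y0) + of_bool (snd (incoming \<omega> (Suc x0, Suc y0)))"
      using elim(1) by (rule empty_count_Suc_column)
    have e3: "empty_count \<omega> (Suc x0, Suc y0) = empty_count \<omega> (x0, Suc y0) +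
        of_bool (snd (\<omega> ((x, y), incoming \<omega> (x, y))))"
      using empty_count_Suc_column[OF elim(1), of x0 "Suc y0"] unfolding xy
      by (simp add: incoming.simps[of _ _ "Suc (Suc y0)"])
    have key: "\<omega> \<in> F j \<longleftrightarrow> empty_count \<omega> (Suc x0, Suc y0) = v c" if "\<omega> \<in> E j" for j
    proof -
      have v: "empty_count \<omega> (x0, y0) = j" "empty_count \<omega> (x0, Suc y0) = v (c - 1)" "empty_count \<omega> (Suc x0, y0) = v (c + 1)"
      proof -
        have i: "c - 1 \<le> L" "c - 1 \<noteq> c" "c + 1 \<le> L" "c + 1 \<noteq> c" using c by auto
        then have "empty_count \<omega> (pt S0 (c - 1)) = v (c - 1)" "empty_count \<omega> (pt S0 (c + 1)) = v (c + 1)"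
          using that unfolding E_iff by blast+
        then show "empty_count \<omega> (x0, Suc y0) = v (c - 1)" "empty_count \<omega> (Suc x0, y0) = v (c + 1)"
          unfolding pt_before pt_after .
        show "empty_count \<omega> (x0, y0) = j" using that unfolding E_iff by blast
      qed
      have "incoming \<omega> (x, y) = s j"
        using e1 e2 v unfolding s_def xy by (intro prod_eqI) (auto split: if_splits)
      then show ?thesis using elim(2) e3 v by (auto simp: F_def X_def)
    qed
    show ?case
    proof
      assume G: "\<omega> \<in> height_cylinder Q \<xi> u N S1 v"
      then have "\<omega> \<in> E (empty_count \<omega> (x0, y0))" by (simp add: E_iff G_iff)
      moreover have "empty_count \<omega> (x0, Suc y0) = v (c - 1)"
      proof -
        have "c - 1 \<le> L" "c - 1 \<noteq> c" using c by auto
        then have "empty_count \<omega> (pt S0 (c - 1)) = v (c - 1)" using G unfolding G_iff by blast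
        then show ?thesis unfolding pt_before .
      qed
      then have "empty_count \<omega> (x0, y0) \<le> v (c - 1)" using e1 by simp
      ultimately show "\<omega> \<in> (\<Union>j\<le>v (c - 1). E j \<inter> F j)" using key G by (auto simp: G_iff)
    next
      assume "\<omega> \<in> (\<Union>j\<le>v (c - 1). E j \<inter> F j)"
      then show "\<omega> \<in> height_cylinder Q \<xi> u N S1 v" using key by (auto simp: E_iff G_iff)
    qed
  qed
  then have "height_mass Q \<xi> u N S1 v = emeasure D (\<Union>j\<le>v (c - 1). E j \<inter> F j)"
    unfolding height_mass_def D_def[symmetric]
    by (rule emeasure_eq_AE) (auto simp: D_def intro!: height_cylinder_sets sets.finite_UN sets[unfolded D_def])
  also have "\<dots> = (\<Sum>j\<le>v (c - 1). emeasure D (E j \<inter> F j))"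
    by (rule sum_emeasure[symmetric]) (auto simp: disjoint_family_on_def E_iff)
  also have "\<dots> = (\<Sum>j\<le>v (c - 1). ennreal (vertex_kernel Q (\<xi> x * u y) j (v (c - 1)) (v (c + 1)) (v c)) *
        height_mass Q \<xi> u N S0 (v(c := j)))"
    unfolding indep by (simp add: height_mass_def E_def D_def mult.commute)
  finally show ?thesis .
qed

text \<open>This path runs down the left boundary, where all arrows enter, and then along the bottom
  axis, so every count on it is zero.\<close>

lemma height_mass_replicate:
  "height_mass Q \<xi> u N (replicate N Minus @ replicate M Plus) v = of_bool (\<forall>i\<le>M + N. v i = 0)"
proof -
  let ?S = "replicate N Minus @ replicate M Plus"
  have cnt: "count_list (replicate n Plus) Minus = 0" "count_list (replicate n Minus) Plus = 0"
    "count_list (replicate n Minus) Minus = n" for n by (induction n) auto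
  have "empty_count \<omega> (pluses ?S i, N - minuses ?S i) = 0" for \<omega> i
  proof (cases "i \<le> N")
    case True
    then have "pluses ?S i = 0" by (simp add: pluses_def cnt)
    then show ?thesis by simp
  next
    case False
    then have "minuses ?S i = N" by (simp add: minuses_def cnt)
    then show ?thesis by simp
  qed
  then have "height_cylinder Q \<xi> u N ?S v =
      (if \<forall>i\<le>M + N. v i = 0 then space (vertex_draws Q \<xi> u) else {})"
    by (auto simp: height_cylinder_def add.commute)
  then show ?thesis
    by (simp add: height_mass_def prob_space.emeasure_space_1[OF prob_space_vertex_draws])
qed

section \<open>Induction over sign strings\<close>

primrec inversions :: "sign list \<Rightarrow> nat" where
  "inversions [] = 0"
| "inversions (s # S) = (case s of Plus \<Rightarrow> count_list S Minus | Minus \<Rightarrow> 0) + inversions S"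

lemma inversions_swap:
  "inversions (U @ [Plus, Minus] @ V) = Suc (inversions (U @ [Minus, Plus] @ V))"
  by (induction U) (auto split: sign.split)

text \<open>A string without a plus immediately followed by a minus is sorted; otherwise undoing
  such a pair lowers the number of inversions by one. This is what makes the induction
  exhaustive.\<close>

lemma sign_list_cases:
  obtains n m where "S = replicate n Minus @ replicate m Plus"
  | U V where "S = U @ [Plus, Minus] @ V"
proof -
  have "(\<exists>n m. S = replicate n Minus @ replicate m Plus) \<or> (\<exists>U V. S = U @ [Plus, Minus] @ V)"
  proof (induction S)
    case Nil
    have "[] = replicate 0 Minus @ replicate 0 Plus" by simp
    then show ?case by blast
  next
    case (Cons s S)
    from Cons.IH show ?case
    proof (elim disjE exE)
      fix n m assume S: "S = replicate n Minus @ replicate m Plus"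
      show ?thesis
      proof (cases s)
        case Minus
        then have "s # S = replicate (Suc n) Minus @ replicate m Plus" using S by simp
        then show ?thesis by blast
      next
        case Plus
        show ?thesis
        proof (cases n)
          case 0
          then have "s # S = replicate 0 Minus @ replicate (Suc m) Plus" using S Plus by simp
          then show ?thesis by blast
        next
          case (Suc n')
          then have "s # S = [] @ [Plus, Minus] @ replicate n' Minus @ replicate m Plus" using S Plus by simp
          then show ?thesis by blast
        qed
      qed
    next
      fix U V assume "S = U @ [Plus, Minus] @ V"
      then have "s # S = (s # U) @ [Plus, Minus] @ V" by simp
      then show ?thesis by blast
    qed
  qed
  then show ?thesis using that by blast
qed

lemma length_eq_sign_counts: "length S = count_list S Plus + count_list S Minus"
proof (induction S)
  case (Cons s S)
  then show ?case by (cases s) auto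
qed simp

lemma measurable_map_count_space:
  fixes F :: "'a \<Rightarrow> 'i \<Rightarrow> 'b :: countable"
  assumes "\<And>i. i \<in> set xs \<Longrightarrow> (\<lambda>c. F c i) \<in> M \<rightarrow>\<^sub>M count_space UNIV"
  shows "(\<lambda>c. map (F c) xs) \<in> M \<rightarrow>\<^sub>M count_space UNIV"
  using assms
proof (induction xs)
  case (Cons x xs)
  have "(\<lambda>c. k # map (F c) xs) \<in> M \<rightarrow>\<^sub>M count_space UNIV" for k
    by (rule measurable_compose[OF Cons.IH[OF Cons.prems], of "Cons k" "count_space UNIV"]) auto
  then have "(\<lambda>c. F c x # map (F c) xs) \<in> M \<rightarrow>\<^sub>M count_space UNIV"
    by (rule measurable_compose_countable[where f = "\<lambda>k c. k # map (F c) xs"]) (use Cons.prems in auto)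
  then show ?case by simp
qed simp

text \<open>Both masses obey the same recursion with the same kernel; the extra factor on the
  partition side is absorbed by the change of the normalisation. The vanishing of \<open>v\<close>
  past \<open>M + N\<close> is what lets a condition on all indices match one on the path.\<close>

lemma HL_mass_eq_height_mass:
  assumes t: "0 < t" "t < 1" and a: "\<And>i. i \<ge> 1 \<Longrightarrow> a i > 0" and b: "\<And>j. j \<ge> 1 \<Longrightarrow> b j > 0"
    and ab: "\<And>i j. i \<ge> 1 \<Longrightarrow> j \<ge> 1 \<Longrightarrow> a i * b j < 1"
    and z: "\<And>x y. x \<ge> 1 \<Longrightarrow> y \<ge> 1 \<Longrightarrow> \<xi> x * u y = 1 / (sqrt t * (a x * b y))"
    and S: "count_list S Plus = M" "count_list S Minus = N"
    and v: "\<And>i. i > M + N \<Longrightarrow> v i = 0"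
  shows "HL_mass t a b N S v = ennreal (HL_norm t a b M N S) * height_mass t \<xi> u N S v"
  using S v
proof (induction "inversions S" arbitrary: S v rule: less_induct)
  case less
  show ?case
  proof (cases S rule: sign_list_cases)
    case (1 n m)
    have cnt: "count_list (replicate k Plus) Minus = 0" "count_list (replicate k Minus) Plus = 0"
      "count_list (replicate k Minus) Minus = k" "count_list (replicate k Plus) Plus = k" for k
      by (induction k) auto
    have "n = N" "m = M" using 1 less.prems by (auto simp: cnt)
    moreover have "(\<forall>i. v i = 0) \<longleftrightarrow> (\<forall>i\<le>M + N. v i = 0)" using less.prems(3) by (meson not_le)
    ultimately show ?thesis
      unfolding 1 by (simp add: HL_mass_replicate height_mass_replicate HL_norm_replicate)
  next
    case (2 U V)
    define S0 where "S0 = U @ [Minus, Plus] @ V"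
    define c x y where "c = Suc (length U)" and "x = Suc (count_list U Plus)" and "y = N - count_list U Minus"
    have cnt: "count_list S0 Plus = M" "count_list S0 Minus = N" using 2 less.prems by (auto simp: S0_def)
    have N: "count_list U Minus < N" using 2 less.prems by auto
    have lenS0: "length S0 = M + N" using length_eq_sign_counts[of S0] cnt by simp
    have c: "c < M + N" using lenS0 by (auto simp: S0_def c_def)
    have xy: "x \<ge> 1" "y \<ge> 1" using N by (auto simp: x_def y_def)
    have pos: "0 < a x" "0 < b y" "a x * b y < 1" using a b ab xy by auto
    define C where "C = (1 - t * (a x * b y)) / (1 - a x * b y)"
    have "t * (a x * b y) < 1" using t pos mult_strict_mono[of t 1 "a x * b y" 1] by auto
    then have C: "C \<ge> 0" using pos by (simp add: C_def)
    have IH: "HL_mass t a b N S0 (v(c := j)) = ennreal (HL_norm t a b M N S0) * height_mass t \<xi> u N S0 (v(c := j))" for j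
    proof (rule less.hyps[OF _ cnt])
      show "inversions S0 < inversions S" unfolding 2 S0_def inversions_swap by simp
      show "(v(c := j)) i = 0" if "i > M + N" for i using that c less.prems(3)[OF that] by simp
    qed
    have "HL_mass t a b N S v = ennreal C *
      (\<Sum>j\<le>v (c - 1). ennreal (vertex_kernel t (\<xi> x * u y) j (v (c - 1)) (v (c + 1)) (v c)) *
        HL_mass t a b N S0 (v(c := j)))"
      unfolding 2 S0_def C_def c_def x_def y_def
      by (rule HL_mass_swap[OF t a b ab N]) (use z[OF xy] in \<open>auto simp: x_def y_def\<close>)
    also have "\<dots> = ennreal C * (ennreal (HL_norm t a b M N S0) *
      (\<Sum>j\<le>v (c - 1). ennreal (vertex_kernel t (\<xi> x * u y) j (v (c - 1)) (v (c + 1)) (v c)) *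
        height_mass t \<xi> u N S0 (v(c := j))))"
      unfolding IH by (simp add: sum_distrib_left mult_ac)
    also have "(\<Sum>j\<le>v (c - 1). ennreal (vertex_kernel t (\<xi> x * u y) j (v (c - 1)) (v (c + 1)) (v c)) *
        height_mass t \<xi> u N S0 (v(c := j))) = height_mass t \<xi> u N S v"
      unfolding 2 S0_def c_def x_def y_def by (rule height_mass_swap[OF N, symmetric])
    also have "ennreal C * (ennreal (HL_norm t a b M N S0) * height_mass t \<xi> u N S v) =
        ennreal (HL_norm t a b M N S) * height_mass t \<xi> u N S v"
    proof -
      have "HL_norm t a b M N S = C * HL_norm t a b M N S0"
        unfolding 2 S0_def C_def x_def y_def by (rule HL_norm_swap[OF N]) (use lenS0 in \<open>simp add: S0_def\<close>)
      then show ?thesis using C by (simp add: ennreal_mult' mult.assoc)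
    qed
    finally show ?thesis .
  qed
qed

section \<open>Equality of the two laws\<close>

theorem theorem4p3:
  fixes t Q :: real and a b \<xi> u :: "nat \<Rightarrow> real" and M N :: nat and S :: "sign list"
  assumes t: "0 < t" "t < 1"
    and a_pos: "\<And>i. i \<ge> 1 \<Longrightarrow> a i > 0"
    and b_pos: "\<And>j. j \<ge> 1 \<Longrightarrow> b j > 0"
    and ab: "\<And>i j. i \<ge> 1 \<Longrightarrow> j \<ge> 1 \<Longrightarrow> a i * b j < 1"
    and Q: "0 < Q" "Q < 1"
    and xi_pos: "\<And>x. x \<ge> 1 \<Longrightarrow> \<xi> x > 0"
    and u_pos: "\<And>y. y \<ge> 1 \<Longrightarrow> u y > 0"
    and xi_u: "\<And>x y. x \<ge> 1 \<Longrightarrow> y \<ge> 1 \<Longrightarrow> \<xi> x * u y > 1 / sqrt Q"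
    and tQ: "t = Q"
    and a_xi: "\<And>x. x \<ge> 1 \<Longrightarrow> a x = sqrt t / \<xi> x"
    and b_u: "\<And>y. y \<ge> 1 \<Longrightarrow> b y = 1 / (t * u y)"
    and M: "M \<ge> 1" and N: "N \<ge> 1"
    and S: "S \<in> strings M N"
  shows "distr (HL_process t a b M N S) (count_space UNIV)
           (\<lambda>\<Lambda>. map (\<lambda>i. int (length (\<Lambda> i))) [1..<M + N]) =
         distr (six_vertex Q \<xi> u) (count_space UNIV)
           (\<lambda>c. map (\<lambda>i. int (path_y N S i) - int (height_fn c (path_x N S i + 1) (path_y N S i)))
                 [1..<M + N])"
    (is "distr ?HL _ ?f = distr ?SV _ ?g")
proof -
  have S_cnt: "count_list S Plus = M" "count_list S Minus = N" using S by (auto simp: strings_def)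
  have lenS: "length S = M + N" using length_eq_sign_counts[of S] S_cnt by simp
  have z: "\<xi> x * u y = 1 / (sqrt t * (a x * b y))" if "x \<ge> 1" "y \<ge> 1" for x y
  proof -
    have "sqrt t * sqrt t = t" using t by simp
    then have "sqrt t * (a x * b y) = t / (t * (\<xi> x * u y))"
      using a_xi[OF that(1)] b_u[OF that(2)] by (simp add: field_simps)
    then show ?thesis using t by simp
  qed
  define norm where "norm = HL_norm t a b M N S"
  have norm: "norm > 0" unfolding norm_def using HL_norm_pos[OF t a_pos b_pos ab lenS] .
  define D where "D = vertex_draws Q \<xi> u"
  define e where "e \<omega> i = empty_count \<omega> (pluses S i, N - minuses S i)" for \<omega> i
  have e0: "e \<omega> 0 = 0" and eL: "e \<omega> (M + N) = 0" for \<omega>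
    using S_cnt lenS by (auto simp: e_def pluses_def minuses_def)
  have g_eq: "?g (restrict (incoming \<omega>) vertices) = map (\<lambda>i. int (e \<omega> i)) [1..<M + N]" for \<omega>
    using lenS by (auto simp: path_x_def path_y_def dr_path_eq e_def height_fn_eq_empty_count[simplified])
  have restr: "(\<lambda>\<omega>. restrict (incoming \<omega>) vertices) \<in> D \<rightarrow>\<^sub>M ?SV"
    using measurable_configuration[of Q \<xi> u] unfolding six_vertex_def D_def by simp
  \<comment> \<open>Writing the law as a pushforward with itself as target makes the two
    pushforwards compose, so the heights can be computed directly from the draws.\<close>
  have SV: "?SV = distr D ?SV (\<lambda>\<omega>. restrict (incoming \<omega>) vertices)"
    by (subst six_vertex_def) (auto simp: six_vertex_def D_def intro!: distr_cong)
  have f_meas: "?f \<in> ?HL \<rightarrow>\<^sub>M count_space UNIV"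
    by (simp add: HL_process_def)
  have g_meas: "?g \<in> ?SV \<rightarrow>\<^sub>M count_space UNIV"
    by (rule measurable_map_count_space)
      (rule measurable_compose[OF measurable_height_fn, where g = "\<lambda>h. int _ - int h"], auto)
  show ?thesis
  proof (rule measure_eqI_countable[where A = UNIV])
    fix w :: "int list"
    have L: "emeasure (distr ?HL (count_space UNIV) ?f) {w} =
      (\<integral>\<^sup>+\<Lambda>. ennreal (1 / norm * HL_weight t a b N S \<Lambda>) * indicator (?f -` {w} \<inter> partition_seqs (M + N)) \<Lambda>
        \<partial>count_space (partition_seqs (M + N)))"
      unfolding HL_process_def norm_def HL_weight_def lenS
      by (subst emeasure_distr) (auto simp: emeasure_density)
    have R: "emeasure (distr ?SV (count_space UNIV) ?g) {w} =
      emeasure D {\<omega> \<in> space D. map (\<lambda>i. int (e \<omega> i)) [1..<M + N] = w}"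
    proof -
      have "distr ?SV (count_space UNIV) ?g = distr D (count_space UNIV) (\<lambda>\<omega>. map (\<lambda>i. int (e \<omega> i)) [1..<M + N])"
        by (subst SV) (simp only: distr_distr[OF g_meas restr] o_def g_eq)
      moreover have "(\<lambda>\<omega>. map (\<lambda>i. int (e \<omega> i)) [1..<M + N]) \<in> D \<rightarrow>\<^sub>M count_space UNIV"
        using measurable_compose[OF restr g_meas] unfolding g_eq .
      ultimately show ?thesis
        by (simp add: emeasure_distr vimage_def Int_def conj_commute)
    qed
    show "emeasure (distr ?HL (count_space UNIV) ?f) {w} = emeasure (distr ?SV (count_space UNIV) ?g) {w}"
    \<comment> \<open>The lists that can occur are those coming from vectors of naturals; extending
      them by zero turns a list into the total function required by the cylinders. Any other list
      has mass zero on both sides.\<close>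
    proof (cases "\<exists>v. v 0 = 0 \<and> (\<forall>i\<ge>M + N. v i = (0::nat)) \<and> w = map (\<lambda>i. int (v i)) [1..<M + N]")
      case True
      then obtain v where v: "v 0 = 0" "\<And>i. i \<ge> M + N \<Longrightarrow> v i = (0::nat)" and w: "w = map (\<lambda>i. int (v i)) [1..<M + N]"
        by blast
      have map_eq: "map (\<lambda>i. int (h i)) [1..<M + N] = w \<longleftrightarrow> (\<forall>i. h i = v i)"
        if "h 0 = 0" "\<And>i. i \<ge> M + N \<Longrightarrow> h i = 0" for h
      proof
        assume *: "map (\<lambda>i. int (h i)) [1..<M + N] = w"
        show "\<forall>i. h i = v i"
        proof
          fix i
          consider "i = 0" | "i \<ge> M + N" | "i \<in> set [1..<M + N]" by (cases "i = 0 \<or> i \<ge> M + N") auto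
          then show "h i = v i" using v that * unfolding w by cases auto
        qed
      qed (auto simp: w)
      have f: "?f -` {w} \<inter> partition_seqs (M + N) = length_cylinder (M + N) v"
      proof -
        have "?f \<Lambda> = w \<longleftrightarrow> (\<forall>i. length (\<Lambda> i) = v i)" if "\<Lambda> \<in> partition_seqs (M + N)" for \<Lambda>
          by (rule map_eq) (use that in \<open>auto simp: partition_seqs_def\<close>)
        then show ?thesis unfolding length_cylinder_def vimage_def by blast
      qed
      have h: "{\<omega> \<in> space D. map (\<lambda>i. int (e \<omega> i)) [1..<M + N] = w} = height_cylinder Q \<xi> u N S v"
      proof -
        have "map (\<lambda>i. int (e \<omega> i)) [1..<M + N] = w \<longleftrightarrow> (\<forall>i\<le>length S. e \<omega> i = v i)" for \<omega>
        proof -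
          \<comment> \<open>The list does not see the indices from \<open>M + N\<close> on, so the
            counts are cut off there to meet the assumptions of \<open>map_eq\<close>; at
            \<open>M + N\<close> itself the count is zero by \<open>eL\<close>.\<close>
          have "map (\<lambda>i. int (e \<omega> i)) [1..<M + N] = map (\<lambda>i. int (if i < M + N then e \<omega> i else 0)) [1..<M + N]"
            by simp
          also have "\<dots> = w \<longleftrightarrow> (\<forall>i. (if i < M + N then e \<omega> i else 0) = v i)"
            using M e0 by (intro map_eq) auto
          also have "\<dots> \<longleftrightarrow> (\<forall>i\<le>length S. e \<omega> i = v i)"
          proof (intro iffI allI impI)
            fix i assume *: "\<forall>i. (if i < M + N then e \<omega> i else 0) = v i" "i \<le> length S"
            then have "(if i < M + N then e \<omega> i else 0) = v i" by blast
            then show "e \<omega> i = v i" using *(2) lenS eL[of \<omega>] by (cases "i = M + N") auto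
          next
            fix i assume "\<forall>i\<le>length S. e \<omega> i = v i"
            then show "(if i < M + N then e \<omega> i else 0) = v i" using v(2)[of i] lenS by auto
          qed
          finally show ?thesis .
        qed
        then show ?thesis unfolding height_cylinder_def e_def D_def by simp
      qed
      have "emeasure (distr ?HL (count_space UNIV) ?f) {w} = ennreal (1 / norm) * HL_mass t a b N S v"
      proof -
        have sub: "length_cylinder (M + N) v \<subseteq> partition_seqs (M + N)" by (auto simp: length_cylinder_def)
        have "emeasure (distr ?HL (count_space UNIV) ?f) {w} =
          (\<integral>\<^sup>+\<Lambda>. ennreal (1 / norm) * (ennreal (HL_weight t a b N S \<Lambda>) * indicator (length_cylinder (M + N) v) \<Lambda>)
            \<partial>count_space (partition_seqs (M + N)))"
        proof -
          have "1 / norm \<ge> 0" using norm by simp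
          then show ?thesis unfolding L f by (simp only: ennreal_mult' mult.assoc)
        qed
        also have "\<dots> = ennreal (1 / norm) * (\<integral>\<^sup>+\<Lambda>. ennreal (HL_weight t a b N S \<Lambda>) * indicator (length_cylinder (M + N) v) \<Lambda>
            \<partial>count_space (partition_seqs (M + N)))"
          by (rule nn_integral_cmult) simp
        also have "(\<integral>\<^sup>+\<Lambda>. ennreal (HL_weight t a b N S \<Lambda>) * indicator (length_cylinder (M + N) v) \<Lambda>
            \<partial>count_space (partition_seqs (M + N))) = HL_mass t a b N S v"
          unfolding HL_mass_def lenS using sub
          by (subst (1 2) nn_integral_count_space_indicator)
            (auto intro!: nn_integral_cong simp: indicator_def)
        finally show ?thesis .
      qed
      also have "\<dots> = ennreal (1 / norm) * (ennreal norm * height_mass t \<xi> u N S v)"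
        unfolding norm_def
        by (subst HL_mass_eq_height_mass[OF t a_pos b_pos ab z S_cnt, where v = v]) (use v(2) in auto)
      also have "\<dots> = height_mass t \<xi> u N S v"
      proof -
        \<comment> \<open>The constant of the measure cancels the factor between the two masses;
          this uses that the normalisation is strictly positive.\<close>
        have "ennreal (1 / norm) * ennreal norm = ennreal (1 / norm * norm)"
          using norm by (intro ennreal_mult[symmetric]) auto
        then have "ennreal (1 / norm) * ennreal norm = 1" using norm by simp
        then show ?thesis by (simp only: mult.assoc[symmetric] mult_1_left)
      qed
      finally show ?thesis unfolding R h unfolding height_mass_def D_def tQ .
    next
      case False
      have no: "map (\<lambda>i. int (h i)) [1..<M + N] \<noteq> w" for h
      proof
        assume "map (\<lambda>i. int (h i)) [1..<M + N] = w"
        then have "w = map (\<lambda>i. int (if 0 < i \<and> i < M + N then h i else 0)) [1..<M + N]"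
          by (auto intro!: map_cong)
        then have "\<exists>v. v 0 = 0 \<and> (\<forall>i\<ge>M + N. v i = (0::nat)) \<and> w = map (\<lambda>i. int (v i)) [1..<M + N]"
          by (intro exI[of _ "\<lambda>i. if 0 < i \<and> i < M + N then h i else 0"]) simp
        then show False using False by contradiction
      qed
      have "?f -` {w} \<inter> partition_seqs (M + N) = {}"
        unfolding vimage_def singleton_iff by (simp only: no) simp
      then have "emeasure (distr ?HL (count_space UNIV) ?f) {w} = 0" unfolding L by simp
      moreover have "emeasure (distr ?SV (count_space UNIV) ?g) {w} = 0" 
        unfolding R by (simp only: no) simp
      ultimately show ?thesis by simp
    qed
  qed auto
qed

end
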